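(* Let $k>0$ be an integer and set $n=2^k$. Let $X$ be a hyperbolic structure on the one-holed torus $\Sigma_{1,1}$ obtained, for this $n$, by taking a hyperbolic pair of pants with geodesic boundary, two of whose boundary geodesics have length $\frac{1}{n}\cdot 2\log(1+\sqrt{2})$, and identifying these two boundary geodesics; let $\alpha$ be the resulting closed geodesic, which is the systole of $X$. The structure $X$ is such that: (1) the systole of $X$ is shorter than $1/n$ times the length of the next shortest curve, which has length at least $2\log(1+\sqrt{2})$; (2) if $\tilde X$ is a degree $n$ cover of $X$, then the systole of $\tilde X$ has length at most $n\,\ell(\alpha)$. Then there are $k$ cyclic covers $\tilde X_i$ of $X$ such that the length of the systole is different for each of these covers.
   Context: $\Sigma_{1,1}$ is the one-holed torus, i.e. the compact orientable surface of genus one with one boundary component; hyperbolic structures on it have totally geodesic boundary. The systole of a hyperbolic surface is a shortest closed geodesic; $\ell(\cdot)$ denotes hyperbolic length. In (1), "the next shortest curve" means the shortest closed geodesic other than the systole and its multiples. Covers carry the pulled-back hyperbolic metric, and a cyclic cover is a regular cover whose group of deck transformations is cyclic. *)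

theory Defs
  imports "HOL-Analysis.Analysis" "HOL-Algebra.Elementary_Groups" "HOL-Algebra.Bij"
begin

section \<open>The hyperbolic plane\<close>

definition upper_half_plane :: "complex set" where
  "upper_half_plane = {z. Im z > 0}"

text \<open>Distance of the metric \<open>|dz| / Im z\<close>, which has curvature \<open>-1\<close>.\<close>

definition hyp_dist :: "complex \<Rightarrow> complex \<Rightarrow> real" where
  "hyp_dist z w = arcosh (1 + (cmod (z - w))\<^sup>2 / (2 * Im z * Im w))"

text \<open>Orientation-reversing isometries are included. Values outside the upper half plane are
  irrelevant.\<close>

definition hyp_isometry :: "(complex \<Rightarrow> complex) \<Rightarrow> bool" where
  "hyp_isometry g \<longleftrightarrow> bij_betw g upper_half_plane upper_half_plane \<and>
     (\<forall>z\<in>upper_half_plane. \<forall>w\<in>upper_half_plane. hyp_dist (g z) (g w) = hyp_dist z w)"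

text \<open>A closed half plane; its boundary is the geodesic \<open>Re z = 0\<close>.\<close>

definition hyp_half_plane :: "complex set" where
  "hyp_half_plane = {z \<in> upper_half_plane. Re z \<ge> 0}"

section \<open>Hyperbolic surfaces with totally geodesic boundary\<close>

text \<open>A hyperbolic structure is an atlas modelled on the closed half plane whose transition maps
  are restrictions of isometries of the hyperbolic plane. Every point of the hyperbolic plane can be
  moved into the interior of the half plane by an isometry, so interior points need no second kind
  of chart.\<close>

record 'a hyp_surface =
  topo :: "'a topology"
  atlas :: "('a set \<times> ('a \<Rightarrow> complex)) set"

definition half_plane_chart :: "'a topology \<Rightarrow> 'a set \<Rightarrow> ('a \<Rightarrow> complex) \<Rightarrow> bool" where
  "half_plane_chart T U \<phi> \<longleftrightarrow> openin T U \<and>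
     openin (top_of_set hyp_half_plane) (\<phi> ` U) \<and>
     homeomorphic_map (subtopology T U) (top_of_set (\<phi> ` U)) \<phi>"

text \<open>In charts, \<open>f\<close> is near every point the restriction of an isometry of the hyperbolic plane. The
  image of \<open>f\<close> need not be open: the inclusion of a subsurface with geodesic boundary qualifies.\<close>

definition locally_isometric ::
    "('a, 'm) hyp_surface_scheme \<Rightarrow> ('b, 'n) hyp_surface_scheme \<Rightarrow> ('a \<Rightarrow> 'b) \<Rightarrow> bool" where
  "locally_isometric S T f \<longleftrightarrow> continuous_map (topo S) (topo T) f \<and>
     (\<forall>(U, \<phi>)\<in>atlas S. \<forall>(V, \<psi>)\<in>atlas T. \<forall>x\<in>U. f x \<in> V \<longrightarrow>
        (\<exists>W g. openin (topo S) W \<and> x \<in> W \<and> W \<subseteq> U \<and> hyp_isometry g \<and>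
           (\<forall>y\<in>W. f y \<in> V \<and> \<psi> (f y) = g (\<phi> y))))"

text \<open>The last clause is the condition on transition maps: \<open>\<psi> = g \<circ> \<phi>\<close> locally on overlaps.\<close>

definition hyp_surface :: "('a, 'm) hyp_surface_scheme \<Rightarrow> bool" where
  "hyp_surface S \<longleftrightarrow> Hausdorff_space (topo S) \<and> second_countable (topo S) \<and>
     (\<Union>(U, \<phi>)\<in>atlas S. U) = topspace (topo S) \<and>
     (\<forall>(U, \<phi>)\<in>atlas S. half_plane_chart (topo S) U \<phi>) \<and>
     locally_isometric S S (\<lambda>x. x)"

definition surface_boundary :: "('a, 'm) hyp_surface_scheme \<Rightarrow> 'a set" where
  "surface_boundary S = {x. \<exists>(U, \<phi>)\<in>atlas S. x \<in> U \<and> Re (\<phi> x) = 0}"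

section \<open>The two topological types\<close>

text \<open>The torus is the product of two unit circles; the open disc removed from it is the open square
  \<open>Re z > 0\<close>, \<open>Re w > 0\<close>.\<close>

definition one_holed_torus :: "(complex \<times> complex) set" where
  "one_holed_torus = {(z, w). cmod z = 1 \<and> cmod w = 1 \<and> (Re z \<le> 0 \<or> Re w \<le> 0)}"

definition pair_of_pants :: "complex set" where
  "pair_of_pants = {z. cmod z \<le> 4 \<and> cmod (z - 2) \<ge> 1 \<and> cmod (z + 2) \<ge> 1}"

definition hyp_structure_on ::
    "('a, 'm) hyp_surface_scheme \<Rightarrow> 'b::topological_space set \<Rightarrow> bool" where
  "hyp_structure_on S M \<longleftrightarrow> hyp_surface S \<and> topo S homeomorphic_space top_of_set M"

section \<open>Closed geodesics\<close>

text \<open>A closed geodesic of length \<open>L\<close> is represented by a unit speed local geodesic on the real line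
  with period \<open>L\<close>. The period need not be minimal, so that multiples are again closed geodesics.\<close>

definition closed_geodesic ::
    "('a, 'm) hyp_surface_scheme \<Rightarrow> (real \<Rightarrow> 'a) \<Rightarrow> real \<Rightarrow> bool" where
  "closed_geodesic S \<gamma> L \<longleftrightarrow> L > 0 \<and> (\<forall>t. \<gamma> (t + L) = \<gamma> t) \<and>
     (\<forall>t. \<exists>\<epsilon>>0. \<exists>(U, \<phi>)\<in>atlas S. \<gamma> ` {t-\<epsilon><..<t+\<epsilon>} \<subseteq> U \<and>
        (\<forall>r\<in>{t-\<epsilon><..<t+\<epsilon>}. \<forall>s\<in>{t-\<epsilon><..<t+\<epsilon>}. hyp_dist (\<phi> (\<gamma> r)) (\<phi> (\<gamma> s)) = \<bar>r - s\<bar>))"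

definition boundary_geodesic ::
    "('a, 'm) hyp_surface_scheme \<Rightarrow> (real \<Rightarrow> 'a) \<Rightarrow> real \<Rightarrow> bool" where
  "boundary_geodesic S \<gamma> L \<longleftrightarrow> closed_geodesic S \<gamma> L \<and> inj_on \<gamma> {0..<L} \<and>
     range \<gamma> \<in> connected_components_of (subtopology (topo S) (surface_boundary S))"

definition is_systole ::
    "('a, 'm) hyp_surface_scheme \<Rightarrow> (real \<Rightarrow> 'a) \<Rightarrow> real \<Rightarrow> bool" where
  "is_systole S \<gamma> L \<longleftrightarrow> closed_geodesic S \<gamma> L \<and>
     (\<forall>\<gamma>' L'. closed_geodesic S \<gamma>' L' \<longrightarrow> L \<le> L')"

definition systole_length :: "('a, 'm) hyp_surface_scheme \<Rightarrow> real \<Rightarrow> bool" where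
  "systole_length S L \<longleftrightarrow> (\<exists>\<gamma>. is_systole S \<gamma> L)"

text \<open>\<open>(\<gamma>, L)\<close> is a multiple of \<open>(\<alpha>, a)\<close>, up to the choice of base point and orientation; the first
  multiple is \<open>\<alpha>\<close> itself.\<close>

definition multiple_of :: "(real \<Rightarrow> 'a) \<Rightarrow> real \<Rightarrow> (real \<Rightarrow> 'a) \<Rightarrow> real \<Rightarrow> bool" where
  "multiple_of \<gamma> L \<alpha> a \<longleftrightarrow> (\<exists>m::nat. m \<ge> 1 \<and> L = real m * a) \<and>
     (\<exists>c. \<exists>\<sigma>\<in>{1, -1}. \<forall>t. \<gamma> t = \<alpha> (\<sigma> * t + c))"

definition next_shortest ::
    "('a, 'm) hyp_surface_scheme \<Rightarrow> (real \<Rightarrow> 'a) \<Rightarrow> real \<Rightarrow> (real \<Rightarrow> 'a) \<Rightarrow> real \<Rightarrow> bool" where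
  "next_shortest S \<alpha> a \<beta> b \<longleftrightarrow> closed_geodesic S \<beta> b \<and> \<not> multiple_of \<beta> b \<alpha> a \<and>
     (\<forall>\<gamma> L. closed_geodesic S \<gamma> L \<and> \<not> multiple_of \<gamma> L \<alpha> a \<longrightarrow> b \<le> L)"

section \<open>Gluing two boundary geodesics\<close>

text \<open>\<open>q\<close> exhibits \<open>X\<close> as the quotient of \<open>P\<close> by \<open>\<gamma>1 t ~ \<gamma>2 t\<close>. As \<open>\<gamma>1\<close> and \<open>\<gamma>2\<close> are arbitrary unit speed
  parametrisations, every twist and both orientations of the gluing are covered.\<close>

definition glued_along ::
    "('p, 'm) hyp_surface_scheme \<Rightarrow> (real \<Rightarrow> 'p) \<Rightarrow> (real \<Rightarrow> 'p) \<Rightarrow> ('p \<Rightarrow> 'a) \<Rightarrow>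
       ('a, 'n) hyp_surface_scheme \<Rightarrow> bool" where
  "glued_along P \<gamma>1 \<gamma>2 q X \<longleftrightarrow> quotient_map (topo P) (topo X) q \<and> locally_isometric P X q \<and>
     (\<forall>x\<in>topspace (topo P). \<forall>y\<in>topspace (topo P). q x = q y \<longleftrightarrow>
        x = y \<or> (\<exists>t. x = \<gamma>1 t \<and> y = \<gamma>2 t) \<or> (\<exists>t. x = \<gamma>2 t \<and> y = \<gamma>1 t))"

section \<open>Covers\<close>

text \<open>The analogue of \<^const>\<open>covering_space\<close> for abstract topologies.\<close>

definition covering_map :: "'c topology \<Rightarrow> 'a topology \<Rightarrow> ('c \<Rightarrow> 'a) \<Rightarrow> bool" where
  "covering_map Y X p \<longleftrightarrow> continuous_map Y X p \<and> p ` topspace Y = topspace X \<and>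
     (\<forall>x\<in>topspace X. \<exists>T. x \<in> T \<and> openin X T \<and>
        (\<exists>v. \<Union>v = {y \<in> topspace Y. p y \<in> T} \<and> (\<forall>u\<in>v. openin Y u) \<and> pairwise disjnt v \<and>
             (\<forall>u\<in>v. homeomorphic_map (subtopology Y u) (subtopology X T) p)))"

text \<open>A connected cover with the pulled-back hyperbolic metric, i.e. the one making \<open>p\<close> a local
  isometry.\<close>

definition hyp_cover ::
    "('c, 'm) hyp_surface_scheme \<Rightarrow> ('a, 'n) hyp_surface_scheme \<Rightarrow> ('c \<Rightarrow> 'a) \<Rightarrow> bool" where
  "hyp_cover Y X p \<longleftrightarrow> hyp_surface Y \<and> connected_space (topo Y) \<and>
     covering_map (topo Y) (topo X) p \<and> locally_isometric Y X p"

definition cover_degree ::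
    "('c, 'm) hyp_surface_scheme \<Rightarrow> ('a, 'n) hyp_surface_scheme \<Rightarrow> ('c \<Rightarrow> 'a) \<Rightarrow> nat \<Rightarrow> bool" where
  "cover_degree Y X p n \<longleftrightarrow> (\<forall>x\<in>topspace (topo X).
     finite {y \<in> topspace (topo Y). p y = x} \<and> card {y \<in> topspace (topo Y). p y = x} = n)"

definition deck_transformations :: "'c topology \<Rightarrow> ('c \<Rightarrow> 'a) \<Rightarrow> ('c \<Rightarrow> 'c) set" where
  "deck_transformations Y p = {h \<in> extensional (topspace Y).
     homeomorphic_map Y Y h \<and> (\<forall>y\<in>topspace Y. p (h y) = p y)}"

definition deck_group :: "'c topology \<Rightarrow> ('c \<Rightarrow> 'a) \<Rightarrow> ('c \<Rightarrow> 'c) monoid" where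
  "deck_group Y p = BijGroup (topspace Y) \<lparr>carrier := deck_transformations Y p\<rparr>"

definition regular_cover :: "'c topology \<Rightarrow> ('c \<Rightarrow> 'a) \<Rightarrow> bool" where
  "regular_cover Y p \<longleftrightarrow> (\<forall>x\<in>topspace Y. \<forall>y\<in>topspace Y. p x = p y \<longrightarrow>
     (\<exists>h\<in>deck_transformations Y p. h x = y))"

definition cyclic_cover ::
    "('c, 'm) hyp_surface_scheme \<Rightarrow> ('a, 'n) hyp_surface_scheme \<Rightarrow> ('c \<Rightarrow> 'a) \<Rightarrow> bool" where
  "cyclic_cover Y X p \<longleftrightarrow> hyp_cover Y X p \<and> regular_cover (topo Y) p \<and>
     cyclic_group (deck_group (topo Y) p)"

text \<open>Connected covers of a surface have countable fibres, so a connected cover of a surface with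
  points in \<open>'a\<close> is always isomorphic to one with points in \<open>'a \<times> nat\<close>. Quantifying over covers with
  points in that type is therefore no restriction.\<close>

type_synonym 'a covering_surface = "('a \<times> nat) hyp_surface"

end

theory Submission
  imports Defs "HOL-Complex_Analysis.Winding_Numbers"
begin

text \<open>For every \<open>m\<close> with \<open>1 \<le> m \<le> k\<close> there is a cyclic cover of degree \<open>m\<close> whose systole has length exactly
\<open>m * a\<close>; these \<open>k\<close> numbers are distinct. The cover is the one that unwraps \<open>\<alpha>\<close>: a lift of \<open>\<alpha>\<close> closes up
only after \<open>\<alpha>\<close> has been traversed \<open>m\<close> times.

A closed geodesic of such a cover projects to a closed geodesic of \<open>X\<close> of the same length. If the
projection is the \<open>l\<close>-fold multiple of \<open>\<alpha>\<close>, then \<open>m\<close> divides \<open>l\<close>, so the length is at least \<open>m * a\<close>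
(\<open>multiple_lifts_length\<close>), and the lift of the \<open>m\<close>-fold multiple attains this value. Otherwise the
length is at least that of the next shortest curve, which exceeds \<open>n * a \<ge> m * a\<close>, as
\<open>m \<le> k < 2 ^ k = n\<close>. This is \<open>systole_of_cover\<close>.

The cover is given by a continuous function \<open>f\<close> from \<open>X\<close> to the punctured plane whose restriction to
\<open>\<alpha>\<close> has degree one: take the pairs \<open>(x, w)\<close> with \<open>w ^ m = f x\<close>. Multiplication of \<open>w\<close> by roots of
unity is a simply transitive cyclic group action on the fibres. Going once around \<open>\<alpha>\<close> multiplies \<open>w\<close>
by a primitive root of unity, so that the lift of \<open>\<alpha>\<close> meets a whole fibre; this makes the cover
connected.

To find \<open>f\<close>, one works on the pair of pants before gluing (\<open>pants_function\<close>). The functions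
\<open>(z - 2) powi e1 * (z + 2) powi e2\<close> have every possible pair of degrees on two given boundary circles,
because the degrees of \<open>z - 2\<close> and \<open>z + 2\<close> on these circles form a unimodular matrix. Choose both degrees
to be one with respect to the parametrisations that are glued. The values at glued points then
differ by the exponential of a single-valued function, which Tietze's extension theorem allows to
divide out, and the corrected function descends to the quotient \<open>X\<close>. The two glued geodesics
do correspond to boundary circles of the planar model, because invariance of domain lets a
homeomorphism match the geodesic boundary with the frontier (\<open>surface_boundary_pants\<close>).\<close>

section \<open>Closed geodesics are continuous\<close>

lemma hyp_half_plane_Im_pos: "z \<in> hyp_half_plane \<Longrightarrow> Im z > 0"
  by (simp add: hyp_half_plane_def upper_half_plane_def)

lemma cmod_diff_from_hyp_dist:
  assumes "Im z > 0" "Im w > 0"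
  shows "(cmod (z - w))\<^sup>2 = 2 * Im z * Im w * (cosh (hyp_dist z w) - 1)"
proof -
  have "1 + (cmod (z - w))\<^sup>2 / (2 * Im z * Im w) \<ge> 1"
    using assms by simp
  then have "cosh (hyp_dist z w) = 1 + (cmod (z - w))\<^sup>2 / (2 * Im z * Im w)"
    unfolding hyp_dist_def by (rule cosh_arcosh_real)
  then show ?thesis
    using assms by (simp add: field_simps)
qed

text \<open>The preceding identity is quadratic in the Euclidean distance once \<open>Im w\<close> is bounded by \<open>Im z\<close> plus that
distance. Solving it bounds the Euclidean distance by a quantity that depends only on \<open>z\<close> and the
hyperbolic distance, and that vanishes with the latter.\<close>

lemma cmod_diff_bound_from_hyp_dist:
  assumes "Im z > 0" "Im w > 0"
  defines "E \<equiv> Im z * (cosh (hyp_dist z w) - 1)"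
  shows "cmod (z - w) \<le> E + sqrt (2 * Im z * E + E\<^sup>2)"
proof -
  let ?d = "cmod (z - w)"
  have "E \<ge> 0"
    using assms cosh_real_ge_1 by simp
  have "Im w \<le> Im z + ?d"
    using abs_Im_le_cmod[of "z - w"] by simp
  then have "?d\<^sup>2 \<le> 2 * E * (Im z + ?d)"
    using cmod_diff_from_hyp_dist[OF assms(1,2)] \<open>E \<ge> 0\<close>
    by (metis E_def mult.assoc mult.commute mult_left_mono mult_nonneg_nonneg zero_le_numeral)
  then have "(?d - E)\<^sup>2 \<le> 2 * Im z * E + E\<^sup>2"
    by (simp add: power2_eq_square algebra_simps)
  then have "?d - E \<le> sqrt (2 * Im z * E + E\<^sup>2)"
    by (rule real_le_rsqrt)
  then show ?thesis by simp
qed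

lemma isCont_hyp_unit_speed:
  assumes "\<epsilon> > 0"
    and "\<And>s. s \<in> {t-\<epsilon><..<t+\<epsilon>} \<Longrightarrow> Im (c s) > 0 \<and> hyp_dist (c t) (c s) = \<bar>t - s\<bar>"
  shows "isCont c t"
proof -
  define E where "E s = Im (c t) * (cosh (t - s) - 1)" for s
  have "isCont E t"
    unfolding E_def by (intro continuous_intros)
  then have "((\<lambda>s. E s + sqrt (2 * Im (c t) * E s + (E s)\<^sup>2)) \<longlongrightarrow>
      E t + sqrt (2 * Im (c t) * E t + (E t)\<^sup>2)) (at t)"
    unfolding isCont_def by (intro tendsto_intros)
  then have lim: "((\<lambda>s. E s + sqrt (2 * Im (c t) * E s + (E s)\<^sup>2)) \<longlongrightarrow> 0) (at t)"
    by (simp add: E_def)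
  have "\<forall>\<^sub>F s in at t. s \<in> {t-\<epsilon><..<t+\<epsilon>}"
    using assms(1) by (intro eventually_at_in_open') auto
  then have "\<forall>\<^sub>F s in at t. norm (c s - c t) \<le> E s + sqrt (2 * Im (c t) * E s + (E s)\<^sup>2)"
  proof (rule eventually_mono)
    fix s assume s: "s \<in> {t-\<epsilon><..<t+\<epsilon>}"
    have "Im (c t) > 0" using assms by simp
    then have "cmod (c t - c s) \<le> E s + sqrt (2 * Im (c t) * E s + (E s)\<^sup>2)"
      using cmod_diff_bound_from_hyp_dist[of "c t" "c s"] assms(2)[OF s]
      by (simp add: E_def)
    then show "norm (c s - c t) \<le> E s + sqrt (2 * Im (c t) * E s + (E s)\<^sup>2)"
      by (simp add: norm_minus_commute)
  qed
  then have "((\<lambda>s. c s - c t) \<longlongrightarrow> 0) (at t)"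
    by (rule Lim_null_comparison[OF _ lim])
  then show ?thesis
    unfolding isCont_def using LIM_zero_iff by blast
qed

lemma half_plane_chartD:
  assumes "half_plane_chart T U \<phi>"
  shows "openin T U" "\<phi> ` U \<subseteq> hyp_half_plane" "inj_on \<phi> U"
    "continuous_map (subtopology T U) euclidean \<phi>"
    "\<And>V. openin T V \<Longrightarrow> V \<subseteq> U \<Longrightarrow> openin (top_of_set (\<phi> ` U)) (\<phi> ` V)"
proof -
  have h: "openin T U" "openin (top_of_set hyp_half_plane) (\<phi> ` U)"
    "homeomorphic_map (subtopology T U) (top_of_set (\<phi> ` U)) \<phi>"
    using assms unfolding half_plane_chart_def by auto
  show "openin T U" by fact
  then have ts: "topspace (subtopology T U) = U"
    using openin_subset by fastforce
  show "\<phi> ` U \<subseteq> hyp_half_plane"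
    using openin_subset[OF h(2)] by simp
  show "inj_on \<phi> U"
    using homeomorphic_imp_injective_map[OF h(3)] ts by simp
  show "continuous_map (subtopology T U) euclidean \<phi>"
    using homeomorphic_imp_continuous_map[OF h(3)] continuous_map_in_subtopology by blast
  show "openin (top_of_set (\<phi> ` U)) (\<phi> ` V)" if "openin T V" "V \<subseteq> U" for V
  proof -
    have "openin (subtopology T U) V"
      using that h(1) by (simp add: openin_open_subtopology)
    then show ?thesis
      using homeomorphic_imp_open_map[OF h(3)] unfolding open_map_def by blast
  qed
qed

lemma hyp_surfaceD:
  assumes "hyp_surface S" "(U, \<phi>) \<in> atlas S"
  shows "half_plane_chart (topo S) U \<phi>"
  using assms unfolding hyp_surface_def by auto

text \<open>The chart in the definition of closed geodesics, with the quantifiers over pairs resolved.\<close>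

lemma closed_geodesic_chart:
  assumes "closed_geodesic S \<gamma> L"
  obtains \<epsilon> U \<phi> where "\<epsilon> > 0" "(U, \<phi>) \<in> atlas S" "\<gamma> ` {t-\<epsilon><..<t+\<epsilon>} \<subseteq> U"
    "\<And>r s. r \<in> {t-\<epsilon><..<t+\<epsilon>} \<Longrightarrow> s \<in> {t-\<epsilon><..<t+\<epsilon>} \<Longrightarrow>
       hyp_dist (\<phi> (\<gamma> r)) (\<phi> (\<gamma> s)) = \<bar>r - s\<bar>"
proof -
  have "\<exists>\<epsilon>>0. \<exists>(U, \<phi>)\<in>atlas S. \<gamma> ` {t-\<epsilon><..<t+\<epsilon>} \<subseteq> U \<and>
      (\<forall>r\<in>{t-\<epsilon><..<t+\<epsilon>}. \<forall>s\<in>{t-\<epsilon><..<t+\<epsilon>}. hyp_dist (\<phi> (\<gamma> r)) (\<phi> (\<gamma> s)) = \<bar>r - s\<bar>)"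
    using assms unfolding closed_geodesic_def by (elim conjE) (erule allE)
  then obtain \<epsilon> c where "\<epsilon> > 0" and c: "c \<in> atlas S"
    "case c of (U, \<phi>) \<Rightarrow> \<gamma> ` {t-\<epsilon><..<t+\<epsilon>} \<subseteq> U \<and>
      (\<forall>r\<in>{t-\<epsilon><..<t+\<epsilon>}. \<forall>s\<in>{t-\<epsilon><..<t+\<epsilon>}. hyp_dist (\<phi> (\<gamma> r)) (\<phi> (\<gamma> s)) = \<bar>r - s\<bar>)"
    by (elim exE conjE bexE)
  moreover obtain U \<phi> where "c = (U, \<phi>)" by (cases c)
  ultimately show thesis by (intro that[of \<epsilon> U \<phi>]) simp_all
qed

text \<open>The definition of a closed geodesic speaks of distances in charts only. Continuity in the chart follows
from the Euclidean bound above and is transported back by the homeomorphism onto the image of the chart.\<close>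

lemma closed_geodesic_continuous:
  assumes S: "hyp_surface S" and \<gamma>: "closed_geodesic S \<gamma> L"
  shows "continuous_map euclideanreal (topo S) \<gamma>"
proof -
  have nbhd: "\<exists>T. open T \<and> t \<in> T \<and> T \<subseteq> \<gamma> -` V" if V: "openin (topo S) V" and tV: "\<gamma> t \<in> V" for V t
  proof -
    obtain \<epsilon> U \<phi> where \<epsilon>: "\<epsilon> > 0" and U: "(U, \<phi>) \<in> atlas S"
      and \<gamma>U: "\<gamma> ` {t-\<epsilon><..<t+\<epsilon>} \<subseteq> U"
      and d: "\<And>r s. r \<in> {t-\<epsilon><..<t+\<epsilon>} \<Longrightarrow> s \<in> {t-\<epsilon><..<t+\<epsilon>} \<Longrightarrow>
        hyp_dist (\<phi> (\<gamma> r)) (\<phi> (\<gamma> s)) = \<bar>r - s\<bar>"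
      by (rule closed_geodesic_chart[OF \<gamma>, of t]) blast
    note c = half_plane_chartD[OF hyp_surfaceD[OF S U]]
    have t: "t \<in> {t-\<epsilon><..<t+\<epsilon>}" using \<epsilon> by simp
    have "isCont (\<lambda>s. \<phi> (\<gamma> s)) t"
    proof (rule isCont_hyp_unit_speed[OF \<epsilon>])
      fix s assume s: "s \<in> {t-\<epsilon><..<t+\<epsilon>}"
      then have "\<phi> (\<gamma> s) \<in> hyp_half_plane" using \<gamma>U c(2) by blast
      then show "Im (\<phi> (\<gamma> s)) > 0 \<and> hyp_dist (\<phi> (\<gamma> t)) (\<phi> (\<gamma> s)) = \<bar>t - s\<bar>"
        using d[OF t s] hyp_half_plane_Im_pos by simp
    qed
    have "openin (topo S) (V \<inter> U)" using V c(1) by blast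
    from c(5)[OF this] obtain D where D: "open D" "\<phi> ` (V \<inter> U) = \<phi> ` U \<inter> D"
      by (auto simp: openin_open)
    have "\<gamma> t \<in> V \<inter> U" using \<gamma>U t tV by blast
    then have "\<phi> (\<gamma> t) \<in> D" using D by blast
    obtain T where T: "open T" "t \<in> T" "\<And>s. s \<in> T \<Longrightarrow> \<phi> (\<gamma> s) \<in> D"
      using \<open>isCont _ t\<close> \<open>open D\<close> \<open>\<phi> (\<gamma> t) \<in> D\<close> unfolding continuous_at_open by meson
    have "T \<inter> {t-\<epsilon><..<t+\<epsilon>} \<subseteq> \<gamma> -` V"
    proof
      fix s assume s: "s \<in> T \<inter> {t-\<epsilon><..<t+\<epsilon>}"
      then have 1: "\<gamma> s \<in> U" using \<gamma>U by blast
      then have "\<phi> (\<gamma> s) \<in> \<phi> ` (V \<inter> U)" using D T s by simp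
      then obtain y where "y \<in> V \<inter> U" "\<phi> y = \<phi> (\<gamma> s)" by force
      then have "\<gamma> s \<in> V" using inj_onD[OF c(3)] 1 by fastforce
      then show "s \<in> \<gamma> -` V" by simp
    qed
    moreover have "open (T \<inter> {t-\<epsilon><..<t+\<epsilon>})" "t \<in> T \<inter> {t-\<epsilon><..<t+\<epsilon>}"
      using T t by (simp_all add: open_Int)
    ultimately show ?thesis by meson
  qed
  have inS: "\<gamma> t \<in> topspace (topo S)" for t
  proof -
    obtain \<epsilon> U \<phi> where "\<epsilon> > 0" and U: "(U, \<phi>) \<in> atlas S" and "\<gamma> ` {t-\<epsilon><..<t+\<epsilon>} \<subseteq> U"
      using closed_geodesic_chart[OF \<gamma>, of t] by metis
    then have "\<gamma> t \<in> U" by auto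
    then show ?thesis
      using openin_subset[OF half_plane_chartD(1)[OF hyp_surfaceD[OF S U]]] by blast
  qed
  have "open (\<gamma> -` V)" if "openin (topo S) V" for V
    using nbhd[OF that] by (subst open_subopen) simp
  then show ?thesis
    unfolding continuous_map_def using inS by (simp add: vimage_def)
qed

section \<open>Continuous logarithms along periodic curves\<close>

text \<open>Two logarithms of the same function differ by multiples of \<open>2 * pi * \<i>\<close>, which form a discrete set, and
the line is connected.\<close>

lemma continuous_exp_eq_imp_diff_constant:
  fixes u v :: "real \<Rightarrow> complex"
  assumes "continuous_on UNIV u" "continuous_on UNIV v" "\<And>t. exp (u t) = exp (v t)"
  obtains c where "\<And>t. u t = v t + c"
proof -
  have "(\<lambda>t. u t - v t) constant_on UNIV"
  proof (rule continuous_discrete_range_constant)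
    show "continuous_on UNIV (\<lambda>t. u t - v t)"
      using assms by (intro continuous_intros)
    fix s
    have "2 * pi \<le> norm ((u t - v t) - (u s - v s))" if ne: "u t - v t \<noteq> u s - v s" for t
    proof -
      obtain i where i: "u t = v t + of_int (2 * i) * pi * \<i>"
        using assms(3)[of t] by (auto simp: exp_eq)
      obtain j where j: "u s = v s + of_int (2 * j) * pi * \<i>"
        using assms(3)[of s] by (auto simp: exp_eq)
      have eq: "(u t - v t) - (u s - v s) = of_int (i - j) * (2 * pi * \<i>)"
        using i j by (simp add: algebra_simps)
      then have "i \<noteq> j" using ne by auto
      then have "\<bar>real_of_int (i - j)\<bar> \<ge> 1" by linarith
      then show ?thesis
        unfolding eq norm_mult norm_of_int by (simp add: norm_mult)
    qed
    then show "\<exists>e>0. \<forall>t. t \<in> UNIV \<and> u t - v t \<noteq> u s - v s \<longrightarrow> e \<le> norm ((u t - v t) - (u s - v s))"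
      by (intro exI[of _ "2 * pi"]) simp
  qed auto
  then obtain c where "\<And>t. u t - v t = c" unfolding constant_on_def by auto
  then have "u t = v t + c" for t by (metis add.commute diff_add_cancel)
  then show thesis by (rule that)
qed

text \<open>The logarithm is taken on the whole line rather than on one period, so that its increment over a
period is the same everywhere; this increment is the degree of the loop.\<close>

lemma periodic_loop_logarithm:
  fixes g :: "real \<Rightarrow> complex"
  assumes g: "continuous_on UNIV g" and per: "\<And>t. g (t + a) = g t" and ne: "\<And>t. g t \<noteq> \<zeta>"
  obtains u where "continuous_on UNIV u" "\<And>t. g t = \<zeta> + exp (u t)"
    "\<And>t. u (t + a) = u t + 2 * pi * \<i> * winding_number (\<lambda>s. g (a * s)) \<zeta>"
proof -
  obtain u where u: "continuous_on UNIV u" "\<And>t. g t - \<zeta> = exp (u t)"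
  proof (rule continuous_logarithm_on_contractible)
    show "continuous_on UNIV (\<lambda>t. g t - \<zeta>)"
      using g by (intro continuous_intros)
  qed (use ne in \<open>auto simp: convex_imp_contractible\<close>)
  obtain c where c: "\<And>t. u (t + a) = u t + c"
  proof (rule continuous_exp_eq_imp_diff_constant)
    show "continuous_on UNIV (\<lambda>t. u (t + a))"
      by (intro continuous_on_compose2[OF u(1)] continuous_intros) auto
    show "exp (u (t + a)) = exp (u t)" for t
      by (simp only: per flip: u(2))
  qed (use u(1) in blast)+
  have p: "path (\<lambda>s. u (a * s))"
    unfolding path_def by (intro continuous_on_compose2[OF u(1)] continuous_intros) auto
  have "winding_number (\<lambda>s. g (a * s)) \<zeta> = winding_number (\<lambda>s. g (a * s) - \<zeta>) 0"
    by (rule winding_number_offset)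
  also have "(\<lambda>s. g (a * s) - \<zeta>) = exp \<circ> (\<lambda>s. u (a * s))"
    by (auto simp: u(2))
  also have "winding_number (exp \<circ> (\<lambda>s. u (a * s))) 0 = (u a - u 0) / (2 * pi * \<i>)"
    using winding_number_compose_exp[OF p] by (simp add: pathfinish_def pathstart_def)
  also have "u a - u 0 = c" using c[of 0] by simp
  finally have "c = 2 * pi * \<i> * winding_number (\<lambda>s. g (a * s)) \<zeta>"
    by simp
  moreover have "g t = \<zeta> + exp (u t)" for t by (simp flip: u(2))
  ultimately show thesis using that u c by simp
qed

section \<open>Functions on the pair of pants with prescribed degree on the boundary\<close>

lemma periodic_add_int_mult:
  fixes g :: "real \<Rightarrow> 'a"
  assumes "\<And>t. g (t + a) = g t"
  shows "g (t + of_int k * a) = g t"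
proof (induction k rule: int_induct[where k=0])
  case (step1 i)
  have "g (t + of_int i * a + a) = g (t + of_int i * a)" by (rule assms)
  then show ?case using step1 by (simp add: algebra_simps)
next
  case (step2 i)
  have "g (t + of_int (i - 1) * a + a) = g (t + of_int (i - 1) * a)" by (rule assms)
  then show ?case using step2 by (simp add: algebra_simps)
qed simp

lemma range_periodic:
  fixes g :: "real \<Rightarrow> 'a"
  assumes "a > 0" "\<And>t. g (t + a) = g t"
  shows "range g = g ` {0..a}"
proof -
  have "g t \<in> g ` {0..a}" for t
  proof
    let ?k = "\<lfloor>t / a\<rfloor>"
    show "g t = g (t + of_int (- ?k) * a)"
      using periodic_add_int_mult[of g a t "- ?k"] assms(2) by simp
    have "of_int ?k \<le> t / a" "t / a \<le> of_int ?k + 1"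
      using floor_correct[of "t / a"] by linarith+
    then have "of_int ?k * a \<le> t" "t \<le> (of_int ?k + 1) * a"
      using assms(1) by (simp_all only: pos_le_divide_eq pos_divide_le_eq)
    then show "t + of_int (- ?k) * a \<in> {0..a}"
      by (simp add: algebra_simps)
  qed
  then show ?thesis by blast
qed

lemma periodic_inj_eq:
  fixes g :: "real \<Rightarrow> 'a"
  assumes per: "\<And>t. g (t + a) = g t" and inj: "inj_on g {0..<a}"
    and s: "s \<in> {0..a}" and t: "t \<in> {0..a}" and eq: "g s = g t" and "s < t"
  shows "s = 0 \<and> t = a"
proof -
  have s': "s \<in> {0..<a}" "0 \<in> {0..<a}" using s t \<open>s < t\<close> by auto
  have ga: "g a = g 0" using per[of 0] by (simp only: add_0)
  show ?thesis
  proof (cases "t = a")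
    case True
    then show ?thesis using inj_onD[OF inj _ s'] eq ga by simp
  next
    case False
    then have "t \<in> {0..<a}" using t by simp
    then show ?thesis using inj_onD[OF inj eq s'(1)] \<open>s < t\<close> by simp
  qed
qed

text \<open>The interior of the circle in the sense of the Jordan curve theorem is the open disc, where a simple
closed curve has one constant winding number \<open>\<plusminus>1\<close>.\<close>

lemma winding_number_simple_loop_circle:
  assumes p: "simple_path p" "pathfinish p = pathstart p" "path_image p = sphere c r" and "r > 0"
  obtains \<epsilon> :: int where "\<epsilon> \<in> {1, -1}" "\<And>z. z \<in> ball c r \<Longrightarrow> winding_number p z = of_int \<epsilon>"
    "\<And>z. z \<notin> cball c r \<Longrightarrow> winding_number p z = 0"
proof -
  have "inside (sphere c r) = ball c r"
    using inside_frontier_eq_interior[of "cball c r"] by (simp add: frontier_cball)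
  then have ins: "inside (path_image p) = ball c r" using p by simp
  have out: "winding_number p z = 0" if "z \<notin> cball c r" for z
    by (rule winding_number_zero_outside[of _ "cball c r"])
       (use p that simple_path_imp_path in auto)
  show thesis
    using simple_closed_path_winding_number_inside[OF p(1)]
  proof cases
    case 1
    then show ?thesis using out ins by (intro that[of 1]) auto
  next
    case 2
    then show ?thesis using out ins by (intro that[of "-1"]) auto
  qed
qed

text \<open>The three frontier circles of the planar model.\<close>

definition pants_circles :: "complex set set" where
  "pants_circles = {sphere 2 1, sphere (-2) 1, sphere 0 4}"

text \<open>These three inequalities contain all that is needed about the relative position of the circles.\<close>

lemma pants_triangle_inequalities:
  "cmod z \<le> cmod (z - 2) + 2" "cmod z \<le> cmod (z + 2) + 2" "4 \<le> cmod (z + 2) + cmod (z - 2)"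
  using norm_triangle_ineq[of "z - 2" 2] norm_triangle_ineq4[of "z + 2" 2]
    norm_triangle_ineq4[of "z + 2" "z - 2"] by simp_all

lemma mem_pants_circles_sphere:
  "z \<in> sphere 2 1 \<longleftrightarrow> cmod (z - 2) = 1" "z \<in> sphere (-2) 1 \<longleftrightarrow> cmod (z + 2) = 1"
  "z \<in> sphere 0 4 \<longleftrightarrow> cmod z = 4"
  by (simp_all add: dist_norm norm_minus_commute flip: norm_minus_cancel[of "-2 - z"])

lemma sphere_in_pants:
  assumes "C \<in> pants_circles" "z \<in> C"
  shows "z \<in> pair_of_pants"
proof -
  from assms consider "cmod (z - 2) = 1" | "cmod (z + 2) = 1" | "cmod z = 4"
    unfolding pants_circles_def using mem_pants_circles_sphere by blast
  then show ?thesis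
    unfolding pair_of_pants_def using pants_triangle_inequalities[of z] by cases simp_all
qed

lemma pants_circles_disjoint:
  assumes "A \<in> pants_circles" "B \<in> pants_circles" "A \<noteq> B"
  shows "A \<inter> B = {}"
proof -
  have False if "z \<in> A" "z \<in> B" for z
    using that assms pants_triangle_inequalities[of z] mem_pants_circles_sphere[of z]
    unfolding pants_circles_def by (elim insertE emptyE) simp_all
  then show ?thesis by blast
qed

lemma pants_avoids: "z \<in> pair_of_pants \<Longrightarrow> z \<noteq> 2 \<and> z \<noteq> -2"
  by (auto simp: pair_of_pants_def)

text \<open>The only data that matter about a parametrised boundary circle are its degrees around the two holes. Up
to the orientation \<open>\<epsilon>\<close> they depend on the circle alone.\<close>

lemma boundary_loop_winding_numbers:
  fixes g :: "real \<Rightarrow> complex"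
  assumes "a > 0" "continuous_on UNIV g" and per: "\<And>t. g (t + a) = g t"
    and inj: "inj_on g {0..<a}" and ran: "range g \<in> pants_circles"
  obtains \<epsilon> x y :: int where "\<epsilon> \<in> {1, -1}"
    "(range g, x, y) \<in> {(sphere 2 1, \<epsilon>, 0), (sphere (-2) 1, 0, \<epsilon>), (sphere 0 4, \<epsilon>, \<epsilon>)}"
    "winding_number (\<lambda>s. g (a * s)) 2 = of_int x"
    "winding_number (\<lambda>s. g (a * s)) (-2) = of_int y"
proof -
  let ?p = "\<lambda>s. g (a * s)"
  have "path ?p"
    unfolding path_def by (intro continuous_on_compose2[OF assms(2)] continuous_intros) auto
  have "simple_path ?p"
  proof (rule simple_pathI[OF \<open>path ?p\<close>])
    fix s t :: real assume "0 \<le> s" "s < t" "t \<le> 1" "g (a * s) = g (a * t)"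
    then have "a * s = 0 \<and> a * t = a"
      using \<open>a > 0\<close> by (intro periodic_inj_eq[OF per inj]) (auto simp: mult_left_le)
    then show "s = 0 \<and> t = 1" using \<open>a > 0\<close> by simp
  qed
  have "pathfinish ?p = pathstart ?p"
    using per[of 0] by (simp add: pathfinish_def pathstart_def)
  have "(*) a ` {0..1} = {0..a}"
    using \<open>a > 0\<close> by (simp add: image_mult_atLeastAtMost)
  then have im: "path_image ?p = range g"
    using range_periodic[of a g, OF \<open>a > 0\<close> per] by (simp add: path_image_def flip: image_image[of g "(*) a"])
  note wn = winding_number_simple_loop_circle[OF \<open>simple_path ?p\<close> \<open>pathfinish ?p = pathstart ?p\<close>]
  from ran consider "range g = sphere 2 1" | "range g = sphere (-2) 1" | "range g = sphere 0 4"
    unfolding pants_circles_def by blast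
  then show thesis
  proof cases
    case 1
    obtain \<epsilon> where e: "\<epsilon> \<in> {1, -1 :: int}" "\<And>z. z \<in> ball 2 1 \<Longrightarrow> winding_number ?p z = of_int \<epsilon>"
      "\<And>z. z \<notin> cball 2 1 \<Longrightarrow> winding_number ?p z = 0"
      by (rule wn[OF im[unfolded 1]]) auto
    show ?thesis
      using that[of \<epsilon> \<epsilon> 0] e(1) e(2)[of 2] e(3)[of "-2"] 1 by (simp add: dist_norm)
  next
    case 2
    obtain \<epsilon> where e: "\<epsilon> \<in> {1, -1 :: int}" "\<And>z. z \<in> ball (-2) 1 \<Longrightarrow> winding_number ?p z = of_int \<epsilon>"
      "\<And>z. z \<notin> cball (-2) 1 \<Longrightarrow> winding_number ?p z = 0"
      by (rule wn[OF im[unfolded 2]]) auto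
    show ?thesis
      using that[of \<epsilon> 0 \<epsilon>] e(1) e(2)[of "-2"] e(3)[of 2] 2 by (simp add: dist_norm)
  next
    case 3
    obtain \<epsilon> where e: "\<epsilon> \<in> {1, -1 :: int}" "\<And>z. z \<in> ball 0 4 \<Longrightarrow> winding_number ?p z = of_int \<epsilon>"
      by (rule wn[OF im[unfolded 3]]) auto
    show ?thesis
      using that[of \<epsilon> \<epsilon> \<epsilon>] e(1) e(2)[of 2] e(2)[of "-2"] 3 by simp
  qed
qed

text \<open>Any two of the vectors \<open>(1, 0)\<close>, \<open>(0, 1)\<close>, \<open>(1, 1)\<close> form a basis of the integer lattice, and signs do
not affect this; hence the system is solvable over the integers.\<close>

lemma unimodular_pair_system:
  fixes \<epsilon> \<delta> x1 y1 x2 y2 :: int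
  assumes "\<epsilon> \<in> {1, -1}" "\<delta> \<in> {1, -1}"
    and "(C, x1, y1) \<in> {(sphere 2 1, \<epsilon>, 0), (sphere (-2) 1, 0, \<epsilon>), (sphere (0::complex) 4, \<epsilon>, \<epsilon>)}"
    and "(C', x2, y2) \<in> {(sphere 2 1, \<delta>, 0), (sphere (-2) 1, 0, \<delta>), (sphere (0::complex) 4, \<delta>, \<delta>)}"
    and "C \<noteq> C'"
  obtains e1 e2 :: int where "e1 * x1 + e2 * y1 = 1" "e1 * x2 + e2 * y2 = 1"
proof -
  define d where "d = x1 * y2 - x2 * y1"
  have "d = \<epsilon> * \<delta> \<or> d = - (\<epsilon> * \<delta>)"
    using assms(3-5) unfolding d_def by (elim insertE emptyE) simp_all
  then have "d * d = 1" using assms(1,2) by auto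
  moreover have "d * (y2 - y1) * x1 + d * (x1 - x2) * y1 = d * d"
    "d * (y2 - y1) * x2 + d * (x1 - x2) * y2 = d * d"
    by (simp_all add: d_def algebra_simps)
  \<comment> \<open>Cramer's rule; the determinant \<open>d\<close> is its own inverse.\<close>
  ultimately show thesis by (intro that[of "d * (y2 - y1)" "d * (x1 - x2)"]) simp_all
qed

text \<open>A continuous map from a compact space onto a Hausdorff space is a quotient map.\<close>

lemma continuous_factor_through_compact:
  fixes f :: "'a::t2_space \<Rightarrow> 'b::metric_space" and h :: "'a \<Rightarrow> 'c::topological_space"
  assumes "compact S" "continuous_on S f" "continuous_on S h"
    and "\<And>x y. x \<in> S \<Longrightarrow> y \<in> S \<Longrightarrow> f x = f y \<Longrightarrow> h x = h y"
  obtains D where "continuous_on (f ` S) D" "\<And>x. x \<in> S \<Longrightarrow> D (f x) = h x"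
proof -
  have "quotient_map (top_of_set S) (top_of_set (f ` S)) f"
    using assms(1,2) by (intro T1_Spaces.continuous_imp_quotient_map)
      (auto simp: compact_space_subtopology image_subset_iff
        intro!: Hausdorff_space_subtopology Hausdorff_space_euclidean)
  moreover have "continuous_map (top_of_set S) euclidean h" using assms(3) by simp
  moreover have "h x = h y" if "x \<in> topspace (top_of_set S)" "y \<in> topspace (top_of_set S)" "f x = f y" for x y
    using assms(4)[of x y] that by (simp only: topspace_euclidean_subtopology)
  ultimately obtain D where D: "continuous_map (top_of_set (f ` S)) euclidean D"
      "\<And>x. x \<in> topspace (top_of_set S) \<Longrightarrow> D (f x) = h x"
    by (rule quotient_map_lift_exists) blast+
  show thesis
  proof (rule that)
    show "continuous_on (f ` S) D" using D(1) by simp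
    show "D (f x) = h x" if "x \<in> S" for x
      using D(2)[of x] that by (simp only: topspace_euclidean_subtopology)
  qed
qed

text \<open>The logarithm \<open>u\<close> is common to both loops. That \<open>G\<close> agrees along \<open>g1\<close> and \<open>g2\<close> makes it descend to the
glued surface, and the increment of \<open>u\<close> makes the resulting function of degree one along the glued curve.\<close>

lemma pants_function:
  fixes g1 g2 :: "real \<Rightarrow> complex"
  assumes "a > 0"
    and g1: "continuous_on UNIV g1" "\<And>t. g1 (t + a) = g1 t" "inj_on g1 {0..<a}" "range g1 \<in> pants_circles"
    and g2: "continuous_on UNIV g2" "\<And>t. g2 (t + a) = g2 t" "inj_on g2 {0..<a}" "range g2 \<in> pants_circles"
    and ne: "range g1 \<noteq> range g2"
  obtains G u where "continuous_on pair_of_pants G" "\<And>z. z \<in> pair_of_pants \<Longrightarrow> G z \<noteq> 0"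
    "continuous_on UNIV u" "\<And>t. u (t + a) = u t + 2 * pi * \<i>"
    "\<And>t. G (g1 t) = exp (u t)" "\<And>t. G (g2 t) = exp (u t)"
proof -
  obtain \<epsilon> x1 y1 where *: "\<epsilon> \<in> {1, -1 :: int}"
    "(range g1, x1, y1) \<in> {(sphere 2 1, \<epsilon>, 0), (sphere (-2) 1, 0, \<epsilon>), (sphere 0 4, \<epsilon>, \<epsilon>)}"
    and w1: "winding_number (\<lambda>s. g1 (a * s)) 2 = of_int x1"
      "winding_number (\<lambda>s. g1 (a * s)) (-2) = of_int y1"
    by (rule boundary_loop_winding_numbers[OF \<open>a > 0\<close> g1])
  obtain \<delta> x2 y2 where **: "\<delta> \<in> {1, -1 :: int}"
    "(range g2, x2, y2) \<in> {(sphere 2 1, \<delta>, 0), (sphere (-2) 1, 0, \<delta>), (sphere 0 4, \<delta>, \<delta>)}"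
    and w2: "winding_number (\<lambda>s. g2 (a * s)) 2 = of_int x2"
      "winding_number (\<lambda>s. g2 (a * s)) (-2) = of_int y2"
    by (rule boundary_loop_winding_numbers[OF \<open>a > 0\<close> g2])
  obtain e1 e2 where e: "e1 * x1 + e2 * y1 = 1" "e1 * x2 + e2 * y2 = 1"
    by (rule unimodular_pair_system[OF *(1) **(1) *(2) **(2) ne])
  define F where "F z = (z - 2) powi e1 * (z + 2) powi e2" for z :: complex
  have F: "continuous_on pair_of_pants F"
    unfolding F_def using pants_avoids by (intro continuous_intros) (auto simp: add_eq_0_iff2)
  have F0: "F z \<noteq> 0" if "z \<in> pair_of_pants" for z
    using pants_avoids[OF that] by (auto simp: F_def add_eq_0_iff2)
  have lift: "\<exists>v. continuous_on UNIV v \<and> (\<forall>t. v (t + a) = v t + 2 * pi * \<i>) \<and> (\<forall>t. F (g t) = exp (v t))"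
    if g: "continuous_on UNIV g" "\<And>t. g (t + a) = g t" "range g \<in> pants_circles"
      and w: "winding_number (\<lambda>s. g (a * s)) 2 = of_int x" "winding_number (\<lambda>s. g (a * s)) (-2) = of_int y"
      and xy: "e1 * x + e2 * y = 1" for g x y
  proof -
    have pp: "g t \<noteq> 2" "g t \<noteq> -2" for t
      using pants_avoids[OF sphere_in_pants[OF g(3)]] by auto
    obtain v where v: "continuous_on UNIV v" "\<And>t. g t = 2 + exp (v t)"
        "\<And>t. v (t + a) = v t + 2 * pi * \<i> * of_int x"
      using periodic_loop_logarithm[OF g(1,2) pp(1)] w(1) by metis
    obtain v' where v': "continuous_on UNIV v'" "\<And>t. g t = -2 + exp (v' t)"
        "\<And>t. v' (t + a) = v' t + 2 * pi * \<i> * of_int y"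
      using periodic_loop_logarithm[OF g(1,2) pp(2)] w(2) by metis
    have "F (g t) = exp (of_int e1 * v t + of_int e2 * v' t)" for t
    proof -
      have "g t - 2 = exp (v t)" "g t + 2 = exp (v' t)"
        using v(2)[of t] v'(2)[of t] by simp_all
      then show ?thesis by (simp add: F_def exp_power_int exp_add)
    qed
    moreover have "of_int e1 * v (t + a) + of_int e2 * v' (t + a) =
        of_int e1 * v t + of_int e2 * v' t + 2 * pi * \<i>" for t
    proof -
      have "of_int e1 * v (t + a) + of_int e2 * v' (t + a) =
        of_int e1 * v t + of_int e2 * v' t + 2 * pi * \<i> * of_int (e1 * x + e2 * y)"
        unfolding v(3) v'(3) by (simp add: algebra_simps)
      then show ?thesis unfolding xy by simp
    qed
    moreover have "continuous_on UNIV (\<lambda>t. of_int e1 * v t + of_int e2 * v' t)"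
      using v(1) v'(1) by (intro continuous_intros)
    ultimately show ?thesis by (intro exI[of _ "\<lambda>t. of_int e1 * v t + of_int e2 * v' t"]) simp
  qed
  obtain v1 where v1: "continuous_on UNIV v1" "\<And>t. v1 (t + a) = v1 t + 2 * pi * \<i>" "\<And>t. F (g1 t) = exp (v1 t)"
    using lift[OF g1(1,2,4) w1 e(1)] by auto
  obtain v2 where v2: "continuous_on UNIV v2" "\<And>t. v2 (t + a) = v2 t + 2 * pi * \<i>" "\<And>t. F (g2 t) = exp (v2 t)"
    using lift[OF g2(1,2,4) w2 e(2)] by auto
  have d: "v1 (t + a) - v2 (t + a) = v1 t - v2 t" for t
    using v1 v2 by simp
  have "v1 s - v2 s = v1 t - v2 t" if st: "s \<in> {0..a}" "t \<in> {0..a}" "g2 s = g2 t" for s t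
  proof -
    consider "s = t" | "s < t" | "t < s" by linarith
    then show ?thesis
      using periodic_inj_eq[OF g2(2,3) st] periodic_inj_eq[OF g2(2,3) st(2,1)] st(3) d[of 0] by cases auto
  qed
  moreover have "continuous_on {0..a} g2" "continuous_on {0..a} (\<lambda>t. v1 t - v2 t)"
    using v1(1) v2(1) g2(1) by (auto intro: continuous_on_subset continuous_on_diff)
  ultimately obtain D where D: "continuous_on (g2 ` {0..a}) D" "\<And>t. t \<in> {0..a} \<Longrightarrow> D (g2 t) = v1 t - v2 t"
    using continuous_factor_through_compact[of "{0..a}" g2 "\<lambda>t. v1 t - v2 t"] compact_Icc by metis
  have r2: "range g2 = g2 ` {0..a}" and r1: "range g1 = g1 ` {0..a}"
    using range_periodic[OF \<open>a > 0\<close>] g1(2) g2(2) by blast+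
  \<comment> \<open>Both sides are periodic, so it suffices to know this on one period.\<close>
  have D_all: "D (g2 t) = v1 t - v2 t" for t
  proof -
    have "range (\<lambda>t. (g2 t, v1 t - v2 t)) = (\<lambda>t. (g2 t, v1 t - v2 t)) ` {0..a}"
      by (rule range_periodic) (use \<open>a > 0\<close> d g2(2) in auto)
    then obtain s where "s \<in> {0..a}" "(g2 t, v1 t - v2 t) = (g2 s, v1 s - v2 s)" by blast
    then show ?thesis using D(2)[of s] by simp
  qed
  have disj: "range g1 \<inter> range g2 = {}"
    by (rule pants_circles_disjoint[OF g1(4) g2(4) ne])
  have cl: "closed (range g1)" "closed (range g2)"
    using g1(4) g2(4) unfolding pants_circles_def by auto
  \<comment> \<open>The correction is trivial on \<open>g1\<close> and turns the logarithm \<open>v2\<close> on \<open>g2\<close> into \<open>v1\<close>.\<close>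
  define U where "U z = (if z \<in> range g1 then 0 else D z)" for z
  have "continuous_on (range g1 \<union> range g2) U"
    unfolding U_def using cl disj D(1)[folded r2]
    by (intro continuous_on_cases) auto
  then obtain V where V: "continuous_on UNIV V" "\<And>z. z \<in> range g1 \<union> range g2 \<Longrightarrow> V z = U z"
    using Tietze_unbounded[of "range g1 \<union> range g2" U UNIV] cl by auto
  show thesis
  proof
    show "continuous_on pair_of_pants (\<lambda>z. F z * exp (V z))"
      using F V(1) by (intro continuous_intros) (auto intro: continuous_on_subset)
    show "F z * exp (V z) \<noteq> 0" if "z \<in> pair_of_pants" for z using F0[OF that] by simp
    show "continuous_on UNIV v1" by fact
    show "v1 (t + a) = v1 t + 2 * pi * \<i>" for t by fact
    show "F (g1 t) * exp (V (g1 t)) = exp (v1 t)" for t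
      using V(2)[of "g1 t"] v1(3) by (simp add: U_def)
    show "F (g2 t) * exp (V (g2 t)) = exp (v1 t)" for t
    proof -
      have "g2 t \<notin> range g1" using disj by blast
      then have "V (g2 t) = v1 t - v2 t" using V(2)[of "g2 t"] D_all by (simp add: U_def)
      then show ?thesis using v2(3) by (simp flip: exp_add)
    qed
  qed
qed

section \<open>The boundary of a hyperbolic pair of pants\<close>

text \<open>Invariance of domain for the transition map from a chart with open image to an injective planar map. It
serves to compare a half plane chart with the planar model in both directions.\<close>

lemma invariance_of_domain_between_charts:
  fixes e f :: "'a \<Rightarrow> complex"
  assumes e: "homeomorphic_map T (top_of_set A) e" and "open A"
    and f: "continuous_map T euclidean f" and inj: "inj_on f (topspace T)"
  shows "open (f ` topspace T)"
proof -
  obtain e' where e': "homeomorphic_maps T (top_of_set A) e e'"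
    using e homeomorphic_map_maps by blast
  then have cont: "continuous_map (top_of_set A) T e'"
    and im: "e' ` A = topspace T" and inj': "inj_on e' A"
    using homeomorphic_imp_continuous_map[of "top_of_set A" T e']
      homeomorphic_imp_surjective_map[of "top_of_set A" T e']
      homeomorphic_imp_injective_map[of "top_of_set A" T e']
    by (simp_all add: homeomorphic_maps_map)
  have "open ((f \<circ> e') ` A)"
  proof (rule Further_Topology.invariance_of_domain[OF _ \<open>open A\<close>])
    show "continuous_on A (f \<circ> e')"
      using continuous_map_compose[OF cont f] by simp
    show "inj_on (f \<circ> e') A"
      by (rule comp_inj_on[OF inj']) (use inj im in simp)
  qed
  then show ?thesis by (simp only: image_comp[symmetric] im)
qed

text \<open>Each circle is the boundary of a disc or of the complement of a disc that contains the pair of pants, and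
interiors are monotone.\<close>

lemma interior_pants: "interior pair_of_pants = pair_of_pants - \<Union> pants_circles"
proof
  have "pair_of_pants \<subseteq> cball 0 4" "pair_of_pants \<subseteq> - ball 2 1" "pair_of_pants \<subseteq> - ball (-2) 1"
    by (auto simp: pair_of_pants_def dist_norm norm_minus_commute)
  then have "interior pair_of_pants \<subseteq> interior (cball 0 4)"
    "interior pair_of_pants \<subseteq> interior (- ball 2 1)" "interior pair_of_pants \<subseteq> interior (- ball (-2) 1)"
    by (simp_all only: interior_mono)
  then have "interior pair_of_pants \<subseteq> ball 0 4" "interior pair_of_pants \<subseteq> - cball 2 1"
    "interior pair_of_pants \<subseteq> - cball (-2) 1"
    by (simp_all add: interior_complement)
  moreover have "interior pair_of_pants \<subseteq> pair_of_pants" by (rule interior_subset)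
  ultimately show "interior pair_of_pants \<subseteq> pair_of_pants - \<Union> pants_circles"
    unfolding pants_circles_def by auto
  let ?V = "{z. cmod z < 4} \<inter> {z. cmod (z - 2) > 1} \<inter> {z. cmod (z + 2) > 1}"
  have "open ?V"
    by (intro open_Int open_Collect_less continuous_intros)
  moreover have "?V \<subseteq> pair_of_pants" by (auto simp: pair_of_pants_def)
  moreover have "pair_of_pants - \<Union> pants_circles \<subseteq> ?V"
  proof
    fix z assume z: "z \<in> pair_of_pants - \<Union> pants_circles"
    then have "z \<notin> sphere 2 1" "z \<notin> sphere (-2) 1" "z \<notin> sphere 0 4" 
      by (auto simp: pants_circles_def)
    then show "z \<in> ?V"
      using z unfolding mem_pants_circles_sphere by (auto simp: pair_of_pants_def)
  qed
  ultimately show "pair_of_pants - \<Union> pants_circles \<subseteq> interior pair_of_pants"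
    by (meson interior_maximal order_trans)
qed

text \<open>A boundary point that went to the interior of the planar model would have a planar neighbourhood mapped
homeomorphically into the half plane, with open image through a point of the line \<open>Re z = 0\<close>. Conversely
a point in the open half plane has a planar neighbourhood, whose image in the model is open, and no point of
the three circles is interior.\<close>

lemma surface_boundary_pants:
  assumes P: "hyp_surface P" and h: "homeomorphic_map (topo P) (top_of_set pair_of_pants) h"
    and x: "x \<in> topspace (topo P)"
  shows "x \<in> surface_boundary P \<longleftrightarrow> h x \<in> \<Union> pants_circles"
proof -
  have hx: "h y \<in> pair_of_pants" if "y \<in> topspace (topo P)" for y
    using homeomorphic_imp_surjective_map[OF h] that by auto
  have hc: "continuous_map (topo P) euclidean h"
    using homeomorphic_imp_continuous_map[OF h] continuous_map_in_subtopology by blast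
  have hi: "inj_on h (topspace (topo P))"
    using homeomorphic_imp_injective_map[OF h] .
  show ?thesis
  proof
    assume "x \<in> surface_boundary P"
    then obtain U \<phi> where U: "(U, \<phi>) \<in> atlas P" and xU: "x \<in> U" and re: "Re (\<phi> x) = 0"
      unfolding surface_boundary_def by auto
    note c = half_plane_chartD[OF hyp_surfaceD[OF P U]]
    have UP: "U \<subseteq> topspace (topo P)" using c(1) openin_subset by blast
    show "h x \<in> \<Union> pants_circles"
    proof (rule ccontr)
      assume "h x \<notin> \<Union> pants_circles"
      then have hxi: "h x \<in> interior pair_of_pants" using hx[OF x] interior_pants by auto
      define W where "W = {y \<in> topspace (topo P). h y \<in> interior pair_of_pants} \<inter> U"
      have "openin (topo P) W"
        unfolding W_def using c(1) hc
        by (intro openin_Int openin_continuous_map_preimage[OF hc]) auto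
      have tW: "topspace (subtopology (topo P) W) = W"
        using UP unfolding W_def by auto
      have "openin (top_of_set pair_of_pants) (h ` W)"
        using homeomorphic_imp_open_map[OF h] \<open>openin _ W\<close> unfolding open_map_def by blast
      then obtain D where D: "open D" "h ` W = pair_of_pants \<inter> D" by (auto simp: openin_open)
      have "h ` W = interior pair_of_pants \<inter> D"
        using D(2) interior_subset[of pair_of_pants] unfolding W_def by blast
      then have oW: "open (h ` W)" using D(1) by (simp add: open_Int)
      have "homeomorphic_map (subtopology (topo P) W) (subtopology (top_of_set pair_of_pants) (h ` W)) h"
        by (rule homeomorphic_map_subtopologies[OF h]) (use hx UP in \<open>auto simp: W_def\<close>)
      moreover have "subtopology (top_of_set pair_of_pants) (h ` W) = top_of_set (h ` W)"
        using D(2) by (simp add: subtopology_subtopology)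
      ultimately have "homeomorphic_map (subtopology (topo P) W) (top_of_set (h ` W)) h" by simp
      moreover have "continuous_map (subtopology (topo P) W) euclidean \<phi>"
        by (rule continuous_map_from_subtopology_mono[OF c(4)]) (auto simp: W_def)
      moreover have "inj_on \<phi> (topspace (subtopology (topo P) W))"
        unfolding tW by (rule inj_on_subset[OF c(3)]) (auto simp: W_def)
      ultimately have "open (\<phi> ` W)"
        using invariance_of_domain_between_charts[OF _ oW] tW by metis
      moreover have "\<phi> x \<in> \<phi> ` W" using x xU hxi by (auto simp: W_def)
      ultimately obtain e where e: "e > 0" "ball (\<phi> x) e \<subseteq> \<phi> ` W"
        using open_contains_ball by metis
      \<comment> \<open>A point of the open image to the left of the line \<open>Re z = 0\<close>.\<close>
      have "\<phi> x - of_real (e/2) \<in> ball (\<phi> x) e" using e(1) by (simp add: dist_norm)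
      then have "\<phi> x - of_real (e/2) \<in> hyp_half_plane" using e(2) c(2) unfolding W_def by blast
      then show False using re e(1) by (simp add: hyp_half_plane_def)
    qed
  next
    assume hx': "h x \<in> \<Union> pants_circles"
    show "x \<in> surface_boundary P"
    proof (rule ccontr)
      assume nb: "x \<notin> surface_boundary P"
      have "x \<in> (\<Union>(U, \<phi>)\<in>atlas P. U)" using P x unfolding hyp_surface_def by simp
      then obtain U \<phi> where U: "(U, \<phi>) \<in> atlas P" and xU: "x \<in> U" by auto
      note c = half_plane_chartD[OF hyp_surfaceD[OF P U]]
      have UP: "U \<subseteq> topspace (topo P)" using c(1) openin_subset by blast
      have "Re (\<phi> x) \<noteq> 0" using nb U xU unfolding surface_boundary_def by auto
      moreover have "\<phi> x \<in> hyp_half_plane" using c(2) xU by blast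
      ultimately have rex: "Re (\<phi> x) > 0" by (simp add: hyp_half_plane_def)
      define W where "W = {y \<in> U. Re (\<phi> y) > 0}"
      have tW: "topspace (subtopology (topo P) W) = W" using UP unfolding W_def by auto
      have ch: "openin (top_of_set hyp_half_plane) (\<phi> ` U)"
        "homeomorphic_map (subtopology (topo P) U) (top_of_set (\<phi> ` U)) \<phi>"
        using hyp_surfaceD[OF P U] unfolding half_plane_chart_def by auto
      then obtain D where D: "open D" "\<phi> ` U = hyp_half_plane \<inter> D" by (auto simp: openin_open)
      have "\<phi> ` W = \<phi> ` U \<inter> {z. Re z > 0}" unfolding W_def by auto
      also have "\<dots> = {z. Im z > 0} \<inter> {z. Re z > 0} \<inter> D"
        unfolding D by (auto simp: hyp_half_plane_def upper_half_plane_def)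
      finally have oW: "open (\<phi> ` W)"
        using D(1) by (simp add: open_Int open_halfspace_Re_gt open_halfspace_Im_gt)
      have "homeomorphic_map (subtopology (subtopology (topo P) U) W) (subtopology (top_of_set (\<phi> ` U)) (\<phi> ` W)) \<phi>"
        by (rule homeomorphic_map_subtopologies[OF ch(2)]) (use UP in \<open>auto simp: W_def\<close>)
      moreover have "subtopology (top_of_set (\<phi> ` U)) (\<phi> ` W) = top_of_set (\<phi> ` W)"
        "subtopology (subtopology (topo P) U) W = subtopology (topo P) W"
        unfolding subtopology_subtopology by (rule arg_cong[where f="subtopology _"]; auto simp: W_def)+
      ultimately have "homeomorphic_map (subtopology (topo P) W) (top_of_set (\<phi> ` W)) \<phi>" by simp
      moreover have "continuous_map (subtopology (topo P) W) euclidean h"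
        by (rule continuous_map_from_subtopology[OF hc])
      moreover have "inj_on h (topspace (subtopology (topo P) W))"
        unfolding tW using UP by (intro inj_on_subset[OF hi]) (auto simp: W_def)
      ultimately have "open (h ` W)"
        using invariance_of_domain_between_charts[OF _ oW] tW by metis
      moreover have "h ` W \<subseteq> pair_of_pants" using hx UP by (auto simp: W_def)
      ultimately have "h ` W \<subseteq> interior pair_of_pants" by (rule interior_maximal[rotated])
      moreover have "x \<in> W" using xU rex by (simp add: W_def)
      ultimately show False using hx' interior_pants by blast
    qed
  qed
qed

text \<open>The three circles are connected, closed and disjoint.\<close>

lemma component_of_pants_circles:
  assumes "C \<in> connected_components_of (top_of_set (\<Union> pants_circles))"
  shows "C \<in> pants_circles"
proof -
  let ?B = "\<Union> pants_circles"
  have CB: "C \<subseteq> ?B" using connected_components_of_subset[OF assms] by simp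
  have "C \<noteq> {}" using nonempty_connected_components_of[OF assms] .
  have "connectedin (top_of_set ?B) C" by (rule connectedin_connected_components_of[OF assms])
  then have conC: "connected C" by (simp add: connectedin_subtopology)
  obtain z A where z: "z \<in> C" "z \<in> A" and A: "A \<in> pants_circles" using CB \<open>C \<noteq> {}\<close> by blast
  have "connected A" "A \<subseteq> ?B"
    using A connected_sphere[where ?'a=complex] unfolding pants_circles_def by auto
  then have "connectedin (top_of_set ?B) A" by (simp add: connectedin_subtopology)
  then have "A \<subseteq> C"
    using connected_components_of_maximal[OF assms] z by (auto simp: disjnt_def)
  moreover have "C \<subseteq> A"
  proof (rule ccontr)
    assume "\<not> C \<subseteq> A"
    let ?R = "\<Union> (pants_circles - {A})"
    have "closed S" if "S \<in> pants_circles" for S using that unfolding pants_circles_def by auto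
    then have "closed A" "closed ?R"
      using A by (auto intro!: closed_Union simp: pants_circles_def)
    moreover have "C \<subseteq> A \<union> ?R" using CB by blast
    moreover have "A \<inter> ?R \<inter> C = {}"
      using pants_circles_disjoint[OF A] by blast
    moreover have "A \<inter> C \<noteq> {}" using z by blast
    moreover have "?R \<inter> C \<noteq> {}" using \<open>\<not> C \<subseteq> A\<close> CB by blast
    ultimately show False using conC unfolding connected_closed by blast
  qed
  ultimately show ?thesis using A by auto
qed

text \<open>The homeomorphism maps components of the boundary to components of the union of the circles. The four facts
are the hypotheses that \<open>pants_function\<close> makes on each of its loops.\<close>

lemma boundary_geodesic_in_pants:
  assumes P: "hyp_surface P" and h: "homeomorphic_map (topo P) (top_of_set pair_of_pants) h"
    and \<gamma>: "boundary_geodesic P \<gamma> a"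
  shows "range (\<lambda>t. h (\<gamma> t)) \<in> pants_circles" "inj_on (\<lambda>t. h (\<gamma> t)) {0..<a}"
    "continuous_on UNIV (\<lambda>t. h (\<gamma> t))" "h (\<gamma> (t + a)) = h (\<gamma> t)"
proof -
  have g: "closed_geodesic P \<gamma> a" "inj_on \<gamma> {0..<a}"
    "range \<gamma> \<in> connected_components_of (subtopology (topo P) (surface_boundary P))"
    using \<gamma> unfolding boundary_geodesic_def by auto
  show "h (\<gamma> (t + a)) = h (\<gamma> t)" using g(1) unfolding closed_geodesic_def by simp
  have cont: "continuous_map euclideanreal (topo P) \<gamma>" by (rule closed_geodesic_continuous[OF P g(1)])
  then have ran: "range \<gamma> \<subseteq> topspace (topo P)" by (auto simp: continuous_map_def)
  have hc: "continuous_map (topo P) euclidean h"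
    using homeomorphic_imp_continuous_map[OF h] continuous_map_in_subtopology by blast
  show "continuous_on UNIV (\<lambda>t. h (\<gamma> t))"
    using continuous_map_compose[OF cont hc] by (simp add: o_def)
  have hi: "inj_on h (topspace (topo P))" using homeomorphic_imp_injective_map[OF h] .
  have "inj_on (h \<circ> \<gamma>) {0..<a}"
    using ran by (intro comp_inj_on[OF g(2)] inj_on_subset[OF hi]) auto
  then show "inj_on (\<lambda>t. h (\<gamma> t)) {0..<a}" by (simp add: o_def)
  have "homeomorphic_map (subtopology (topo P) (surface_boundary P))
      (subtopology (top_of_set pair_of_pants) (\<Union> pants_circles)) h"
    using h surface_boundary_pants[OF P h] by (intro homeomorphic_map_subtopologies_alt) auto
  moreover have "subtopology (top_of_set pair_of_pants) (\<Union> pants_circles) = top_of_set (\<Union> pants_circles)"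
    unfolding subtopology_subtopology using sphere_in_pants
    by (intro arg_cong[where f="subtopology _"]) blast
  ultimately have "h ` range \<gamma> \<in> connected_components_of (top_of_set (\<Union> pants_circles))"
    using homeomorphic_map_connected_components_of g(3) by (metis imageI)
  then have "h ` range \<gamma> \<in> pants_circles" by (rule component_of_pants_circles)
  then show "range (\<lambda>t. h (\<gamma> t)) \<in> pants_circles" by (simp add: image_image)
qed

text \<open>The torus with a hole is the union of two annuli, \<open>A \<times> S\<close> and \<open>S \<times> A\<close> for a semicircle \<open>A\<close> of the circle
\<open>S\<close>, that meet.\<close>

lemma connected_one_holed_torus: "connected one_holed_torus"
proof -
  define S where "S = sphere (0::complex) 1"
  define A where "A = {z \<in> S. Re z \<le> 0}"
  have "connected S" unfolding S_def by (rule connected_sphere) simp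
  have "A = cis ` {pi/2..3*pi/2}"
  proof
    show "cis ` {pi/2..3*pi/2} \<subseteq> A"
    proof
      fix z assume "z \<in> cis ` {pi/2..3*pi/2}"
      then obtain t where t: "z = cis t" "t \<in> {pi/2..3*pi/2}" by blast
      have "cos (t - pi) \<ge> 0" using t by (intro cos_ge_zero) auto
      then show "z \<in> A" using t by (simp add: A_def S_def)
    qed
    show "A \<subseteq> cis ` {pi/2..3*pi/2}"
    proof
      fix z assume z: "z \<in> A"
      then have "z \<noteq> 0" and n: "cmod z = 1" by (auto simp: A_def S_def)
      \<comment> \<open>The semicircle is centred at \<open>-1\<close>, and \<open>Arg\<close> of the opposite point has no jump there.\<close>
      define t where "t = Arg (- z)"
      have "- z = cis t"
        using rcis_cmod_Arg[of "- z"] n by (simp add: t_def rcis_def)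
      then have "z = - cis t" by (metis minus_minus)
      then have zt: "z = cis (t + pi)" by (simp flip: cis_mult)
      moreover have "t \<in> {-(pi/2)..pi/2}"
        using Arg_Re_nonneg[of "- z"] z \<open>z \<noteq> 0\<close> by (auto simp: t_def A_def abs_le_iff)
      ultimately show "z \<in> cis ` {pi/2..3*pi/2}" by (intro image_eqI[of _ _ "t + pi"]) auto
    qed
  qed
  then have "connected A"
    by (simp only:) (intro connected_continuous_image continuous_intros connected_Icc)
  have "one_holed_torus = A \<times> S \<union> S \<times> A"
    unfolding one_holed_torus_def A_def S_def by auto
  moreover have "(-1, -1) \<in> (A \<times> S) \<inter> (S \<times> A)" by (simp add: A_def S_def)
  ultimately show ?thesis
    using connected_Un[OF connected_Times[OF \<open>connected A\<close> \<open>connected S\<close>] connected_Times[OF \<open>connected S\<close> \<open>connected A\<close>]]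
    by auto
qed

section \<open>The cover by roots of a nowhere vanishing function\<close>

lemma continuous_map_complex_compose2:
  fixes g k :: "'a \<Rightarrow> complex" and h :: "complex \<Rightarrow> complex \<Rightarrow> complex"
  assumes "continuous_map T euclidean g" "continuous_map T euclidean k"
    and "continuous_on S (\<lambda>z. h (fst z) (snd z))" "\<And>x. x \<in> topspace T \<Longrightarrow> (g x, k x) \<in> S"
  shows "continuous_map T euclidean (\<lambda>x. h (g x) (k x))"
proof -
  have "continuous_map T euclidean (\<lambda>x. (g x, k x))"
    using continuous_map_pairedI[OF assms(1,2)] by simp
  then have "continuous_map T (top_of_set S) (\<lambda>x. (g x, k x))"
    using assms(4) by (auto simp: continuous_map_in_subtopology)
  from continuous_map_compose[OF this, of euclidean "\<lambda>z. h (fst z) (snd z)"] show ?thesis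
    using assms(3) by (simp add: o_def)
qed

text \<open>The setting for the cover \<open>{(x, w). w ^ m = f x}\<close>.\<close>

locale cyclic_root_cover =
  fixes X :: "'a hyp_surface" and f :: "'a \<Rightarrow> complex" and m :: nat
  assumes X: "hyp_surface X"
    and f_cont: "continuous_map (topo X) euclidean f"
    and f_nz: "x \<in> topspace (topo X) \<Longrightarrow> f x \<noteq> 0"
    and m_pos: "m > 0"
begin

definition total_space :: "('a \<times> nat) set" where
  "total_space = topspace (topo X) \<times> {..<m}"

text \<open>The coordinate \<open>w\<close> of the point. The principal root of \<open>f\<close> is discontinuous, and multiplying it by the roots of
unity numbers each fibre by \<open>0, ..., m - 1\<close> in a discontinuous manner; hence the number itself has no
topological meaning, and all arguments below go through \<open>root_of\<close>.\<close>

definition root_of :: "'a \<times> nat \<Rightarrow> complex" where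
  "root_of y = exp (Ln (f (fst y)) / of_nat m) * cis (2 * pi * real (snd y) / real m)"

definition point_over :: "'a \<Rightarrow> complex \<Rightarrow> 'a \<times> nat" where
  "point_over x w = (x, SOME j. j < m \<and> root_of (x, j) = w)"

text \<open>The topology for which \<open>y \<mapsto> (fst y, root_of y)\<close> is an embedding into the product of \<open>X\<close> and the plane.\<close>

definition cover_top :: "('a \<times> nat) topology" where
  "cover_top = pullback_topology total_space (\<lambda>y. (fst y, root_of y)) (prod_topology (topo X) euclidean)"

text \<open>Charts are charts of \<open>X\<close> composed with the projection, on open sets where the projection is injective. The
projection is then an isometry by construction.\<close>

definition cover_surface :: "'a covering_surface" where
  "cover_surface = \<lparr>topo = cover_top,
     atlas = {(V, \<phi> \<circ> fst) | V U \<phi>. (U, \<phi>) \<in> atlas X \<and> openin cover_top V \<and> fst ` V \<subseteq> U \<and> inj_on fst V}\<rparr>"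

lemma topspace_cover_top [simp]: "topspace cover_top = total_space"
  by (auto simp: cover_top_def topspace_pullback_topology total_space_def)

lemma fst_total_space: "y \<in> total_space \<Longrightarrow> fst y \<in> topspace (topo X)"
  by (auto simp: total_space_def)

lemma cis_root_power: "cis (2 * pi * real j / real m) ^ m = 1"
proof -
  have "cis (2 * pi * real j / real m) ^ m = cis (2 * pi * real j)"
    using m_pos by (simp add: Complex.DeMoivre)
  then show ?thesis by (simp add: cis_multiple_2pi)
qed

lemma root_of_power: "y \<in> total_space \<Longrightarrow> root_of y ^ m = f (fst y)"
  using f_nz[OF fst_total_space] m_pos
  by (simp add: root_of_def power_mult_distrib cis_root_power flip: exp_of_nat_mult)

lemma root_of_nz: "root_of y \<noteq> 0"
  by (simp add: root_of_def)

text \<open>A point is determined by its image in \<open>X\<close> and its root, since distinct numbers give distinct roots.\<close>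

lemma total_space_eqI:
  assumes "y \<in> total_space" "y' \<in> total_space" "fst y = fst y'" "root_of y = root_of y'"
  shows "y = y'"
proof -
  have "inj_on (\<lambda>k. cis (2 * pi * real k / real m)) {..<m}"
    using Complex.bij_betw_roots_unity[OF m_pos] by (simp add: bij_betw_def)
  moreover have "cis (2 * pi * real (snd y) / real m) = cis (2 * pi * real (snd y') / real m)"
    using assms(3,4) by (simp add: root_of_def)
  ultimately have "snd y = snd y'" using assms(1,2) by (auto simp: total_space_def inj_on_def)
  then show ?thesis using assms(3) by (simp add: prod_eq_iff)
qed

lemma roots_of_unity: "{z::complex. z ^ m = 1} = (\<lambda>k. cis (2 * pi * real k / real m)) ` {..<m}"
  using Complex.bij_betw_roots_unity[OF m_pos] by (simp add: bij_betw_def)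

lemma
  assumes x: "x \<in> topspace (topo X)" and w: "w ^ m = f x"
  shows point_over_in: "point_over x w \<in> total_space"
    and root_of_point_over: "root_of (point_over x w) = w"
proof -
  let ?r = "exp (Ln (f x) / of_nat m)"
  have "?r ^ m = f x" using f_nz[OF x] m_pos by (simp flip: exp_of_nat_mult)
  then have "(w / ?r) ^ m = 1" using w f_nz[OF x] by (simp add: power_divide)
  then obtain j where "j < m" "w / ?r = cis (2 * pi * real j / real m)" using roots_of_unity by blast
  then have "\<exists>j. j < m \<and> root_of (x, j) = w" by (intro exI[of _ j]) (simp add: root_of_def field_simps)
  then have *: "(SOME j. j < m \<and> root_of (x, j) = w) < m \<and> root_of (x, SOME j. j < m \<and> root_of (x, j) = w) = w"
    by (rule someI_ex)
  show "point_over x w \<in> total_space" "root_of (point_over x w) = w"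
    using * x by (auto simp: point_over_def total_space_def)
qed

lemma fst_point_over [simp]: "fst (point_over x w) = x"
  by (simp add: point_over_def)

lemma point_over_root_of:
  assumes "y \<in> total_space"
  shows "point_over (fst y) (root_of y) = y"
  using assms root_of_power
  by (intro total_space_eqI) (simp_all add: point_over_in root_of_point_over fst_total_space)

lemma continuous_into_product: "continuous_map cover_top (prod_topology (topo X) euclidean) (\<lambda>y. (fst y, root_of y))"
  using continuous_map_pullback[of "prod_topology (topo X) euclidean" _ id total_space "\<lambda>y. (fst y, root_of y)"]
  unfolding cover_top_def by simp

lemma continuous_fst: "continuous_map cover_top (topo X) fst"
  and continuous_root_of: "continuous_map cover_top euclidean root_of"
  using continuous_into_product unfolding continuous_map_paired by auto

lemma continuous_into_cover:
  assumes "continuous_map Z (topo X) (\<lambda>z. fst (g z))" "continuous_map Z euclidean (\<lambda>z. root_of (g z))"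
    and "\<And>z. z \<in> topspace Z \<Longrightarrow> g z \<in> total_space"
  shows "continuous_map Z cover_top g"
  unfolding cover_top_def
proof (rule continuous_map_pullback')
  show "continuous_map Z (prod_topology (topo X) euclidean) ((\<lambda>y. (fst y, root_of y)) \<circ> g)"
    using assms(1,2) by (simp add: o_def continuous_map_paired)
qed (use assms(3) in auto)

text \<open>Lifts of a map to the cover are the same as continuous choices of an \<open>m\<close>-th root of \<open>f\<close> along the map. This
constructs sections over small sets, rotations of the cover and lifts of curves.\<close>

lemma continuous_point_over:
  assumes "continuous_map Z (topo X) g" "continuous_map Z euclidean w"
    and "\<And>z. z \<in> topspace Z \<Longrightarrow> w z ^ m = f (g z)"
  shows "continuous_map Z cover_top (\<lambda>z. point_over (g z) (w z))"
proof (rule continuous_into_cover)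
  have g: "g z \<in> topspace (topo X)" if "z \<in> topspace Z" for z
    using assms(1) that by (auto simp: continuous_map_def)
  show "continuous_map Z (topo X) (\<lambda>z. fst (point_over (g z) (w z)))" using assms(1) by simp
  show "continuous_map Z euclidean (\<lambda>z. root_of (point_over (g z) (w z)))"
    by (rule continuous_map_eq[OF assms(2)]) (simp add: root_of_point_over g assms(3))
  show "point_over (g z) (w z) \<in> total_space" if "z \<in> topspace Z" for z
    using point_over_in[OF g[OF that] assms(3)[OF that]] .
qed

section \<open>The root cover is a covering\<close>

text \<open>On this set \<open>f x / f x0\<close> stays in the right half plane, where the principal logarithm is continuous, so that the
quotient has a continuous \<open>m\<close>-th root.\<close>

definition covered_nbhd :: "'a \<Rightarrow> 'a set" where
  "covered_nbhd x0 = {x \<in> topspace (topo X). Re (f x / f x0) > 0}"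

definition local_root :: "'a \<Rightarrow> 'a \<Rightarrow> complex" where
  "local_root x0 x = exp (Ln (f x / f x0) / of_nat m)"

text \<open>The quotient of \<open>root_of\<close> by the continuous local root is an \<open>m\<close>-th root of the constant \<open>f x0\<close>, hence locally
constant on the cover; its level sets are the sheets.\<close>

definition sheet :: "'a \<Rightarrow> complex \<Rightarrow> ('a \<times> nat) set" where
  "sheet x0 w0 = {y \<in> total_space. fst y \<in> covered_nbhd x0 \<and> root_of y / local_root x0 (fst y) = w0}"

lemma covered_nbhd_self: "x0 \<in> topspace (topo X) \<Longrightarrow> x0 \<in> covered_nbhd x0"
  using f_nz by (simp add: covered_nbhd_def)

lemma continuous_ratio: "continuous_map (topo X) euclidean (\<lambda>x. f x / f x0)"
proof (cases "f x0 = 0")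
  case False
  then show ?thesis
    by (intro continuous_map_complex_compose2[OF f_cont continuous_map_const[THEN iffD2], where S=UNIV and h="\<lambda>z w. z / f x0"] continuous_intros) auto
qed simp

lemma openin_covered_nbhd: "openin (topo X) (covered_nbhd x0)"
proof -
  have "covered_nbhd x0 = {x \<in> topspace (topo X). f x / f x0 \<in> {z. Re z > 0}}"
    by (auto simp: covered_nbhd_def)
  then show ?thesis
    using openin_continuous_map_preimage[OF continuous_ratio, of "{z. Re z > 0}"]
    by (simp add: open_halfspace_Re_gt)
qed

lemma local_root_power:
  assumes "x \<in> covered_nbhd x0"
  shows "local_root x0 x ^ m = f x / f x0"
proof -
  have "f x / f x0 \<noteq> 0" using assms by (auto simp: covered_nbhd_def)
  then have "exp (Ln (f x / f x0)) = f x / f x0" by (rule exp_Ln)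
  then show ?thesis using m_pos by (simp add: local_root_def flip: exp_of_nat_mult)
qed

lemma continuous_local_root: "continuous_map (subtopology (topo X) (covered_nbhd x0)) euclidean (local_root x0)"
proof -
  have c: "continuous_map (subtopology (topo X) (covered_nbhd x0)) euclidean (\<lambda>x. f x / f x0)"
    by (rule continuous_map_from_subtopology[OF continuous_ratio])
  have "Re z > 0 \<Longrightarrow> z \<notin> \<real>\<^sub>\<le>\<^sub>0" for z :: complex
    by (auto simp: complex_nonpos_Reals_iff)
  then have "continuous_on {z::complex. Re z > 0} (\<lambda>z. exp (Ln z / of_nat m))"
    using m_pos by (intro continuous_intros) auto
  then have "continuous_map (subtopology (topo X) (covered_nbhd x0)) euclidean ((\<lambda>z. exp (Ln z / of_nat m)) \<circ> (\<lambda>x. f x / f x0))"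
    using c by (intro continuous_map_compose[where X'="top_of_set {z. Re z > 0}"])
      (auto simp: continuous_map_in_subtopology covered_nbhd_def)
  then show ?thesis by (simp add: o_def local_root_def[abs_def])
qed

lemma local_root_nz: "local_root x0 x \<noteq> 0"
  by (simp add: local_root_def)

lemma sheet_ratio_power:
  assumes "x0 \<in> topspace (topo X)" "y \<in> total_space" "fst y \<in> covered_nbhd x0"
  shows "(root_of y / local_root x0 (fst y)) ^ m = f x0"
  using assms f_nz[OF fst_total_space[OF assms(2)]] f_nz[OF assms(1)]
  by (simp add: power_divide root_of_power local_root_power)

text \<open>A sheet is the preimage of a point of a finite set under a continuous function with values in that set.\<close>

lemma openin_sheet:
  assumes x0: "x0 \<in> topspace (topo X)"
  shows "openin cover_top (sheet x0 w0)"
proof -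
  let ?V = "{y \<in> topspace cover_top. fst y \<in> covered_nbhd x0}"
  let ?g = "\<lambda>y. root_of y / local_root x0 (fst y)"
  let ?R = "{w. w ^ m = f x0}"
  have V: "openin cover_top ?V"
    by (rule openin_continuous_map_preimage[OF continuous_fst openin_covered_nbhd])
  have c: "continuous_map (subtopology cover_top ?V) euclidean ?g"
  proof (rule continuous_map_complex_compose2[where h="(/)" and S="UNIV \<times> (-{0})"])
    show "continuous_map (subtopology cover_top ?V) euclidean root_of"
      by (rule continuous_map_from_subtopology[OF continuous_root_of])
    have "continuous_map (subtopology cover_top ?V) (subtopology (topo X) (covered_nbhd x0)) fst"
      using continuous_map_from_subtopology[OF continuous_fst] by (auto simp: continuous_map_in_subtopology)
    from continuous_map_compose[OF this continuous_local_root]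
    show "continuous_map (subtopology cover_top ?V) euclidean (\<lambda>y. local_root x0 (fst y))" by (simp add: o_def)
    show "continuous_on (UNIV \<times> - {0}) (\<lambda>z::complex \<times> complex. fst z / snd z)"
      by (intro continuous_intros) auto
  qed (simp add: local_root_nz)
  have "finite ?R" using m_pos by (rule finite_nth_roots)
  then have "open (- (?R - {w0}))" by (intro open_Compl finite_imp_closed) auto
  then have "openin (subtopology cover_top ?V) {y \<in> topspace (subtopology cover_top ?V). ?g y \<in> - (?R - {w0})}"
    by (intro openin_continuous_map_preimage[OF c]) simp
  also have "{y \<in> topspace (subtopology cover_top ?V). ?g y \<in> - (?R - {w0})} = sheet x0 w0"
    using sheet_ratio_power[OF x0] by (auto simp: sheet_def)
  finally show ?thesis using V by (rule openin_trans_full)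
qed

lemma homeomorphic_sheet:
  assumes x0: "x0 \<in> topspace (topo X)" and w0: "w0 ^ m = f x0"
  shows "homeomorphic_map (subtopology cover_top (sheet x0 w0)) (subtopology (topo X) (covered_nbhd x0)) fst"
proof -
  let ?T = "subtopology (topo X) (covered_nbhd x0)"
  let ?s = "\<lambda>x. point_over x (w0 * local_root x0 x)"
  have inX: "x \<in> topspace (topo X)" if "x \<in> covered_nbhd x0" for x
    using that by (simp add: covered_nbhd_def)
  have pw: "(w0 * local_root x0 x) ^ m = f x" if "x \<in> covered_nbhd x0" for x
    using w0 f_nz[OF x0] by (simp add: power_mult_distrib local_root_power[OF that])
  have s: "?s x \<in> sheet x0 w0" if "x \<in> covered_nbhd x0" for x
    using that point_over_in[OF inX[OF that] pw[OF that]] root_of_point_over[OF inX[OF that] pw[OF that]]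
    by (simp add: sheet_def local_root_nz)
  have "continuous_map (subtopology cover_top (sheet x0 w0)) ?T fst"
    using continuous_map_from_subtopology[OF continuous_fst] by (auto simp: continuous_map_in_subtopology sheet_def)
  moreover have "continuous_map ?T (subtopology cover_top (sheet x0 w0)) ?s"
    unfolding continuous_map_in_subtopology
  proof
    show "continuous_map ?T cover_top ?s"
    proof (rule continuous_point_over)
      show "continuous_map ?T euclidean (\<lambda>x. w0 * local_root x0 x)"
        by (intro continuous_map_complex_compose2[where g="\<lambda>_. w0" and h="(*)" and S=UNIV]
          continuous_local_root continuous_intros) auto
    qed (use pw in auto)
    show "?s \<in> topspace ?T \<rightarrow> sheet x0 w0" using s by auto
  qed
  moreover have "?s (fst y) = y" if "y \<in> sheet x0 w0" for y
  proof -
    have y: "y \<in> total_space" "w0 * local_root x0 (fst y) = root_of y"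
      using that local_root_nz by (auto simp: sheet_def)
    show ?thesis unfolding y(2) by (rule point_over_root_of[OF y(1)])
  qed
  ultimately have "homeomorphic_maps (subtopology cover_top (sheet x0 w0)) ?T fst ?s"
    by (simp add: homeomorphic_maps_def)
  then show ?thesis by (rule homeomorphic_maps_map[THEN iffD1, THEN conjunct1])
qed

lemma covering_map_fst: "covering_map cover_top (topo X) fst"
  unfolding covering_map_def
proof (intro conjI ballI)
  show "continuous_map cover_top (topo X) fst" by (rule continuous_fst)
  show "fst ` topspace cover_top = topspace (topo X)"
    using m_pos by (auto simp: total_space_def)
  fix x0 assume x0: "x0 \<in> topspace (topo X)"
  let ?v = "sheet x0 ` {w. w ^ m = f x0}"
  have "\<Union> ?v = {y \<in> topspace cover_top. fst y \<in> covered_nbhd x0}"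
    using sheet_ratio_power[OF x0] unfolding sheet_def topspace_cover_top by blast
  moreover have "\<forall>u\<in>?v. openin cover_top u" using openin_sheet[OF x0] by blast
  moreover have "pairwise disjnt ?v"
  proof -
    have "w = w'" if "y \<in> sheet x0 w" "y \<in> sheet x0 w'" for y w w'
      using that by (simp add: sheet_def)
    then show ?thesis unfolding pairwise_def disjnt_def by blast
  qed
  moreover have "\<forall>u\<in>?v. homeomorphic_map (subtopology cover_top u) (subtopology (topo X) (covered_nbhd x0)) fst"
    using homeomorphic_sheet[OF x0] by blast
  ultimately show "\<exists>T. x0 \<in> T \<and> openin (topo X) T \<and>
        (\<exists>v. \<Union>v = {y \<in> topspace cover_top. fst y \<in> T} \<and> (\<forall>u\<in>v. openin cover_top u) \<and> pairwise disjnt v \<and>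
             (\<forall>u\<in>v. homeomorphic_map (subtopology cover_top u) (subtopology (topo X) T) fst))"
    by (intro exI[of _ "covered_nbhd x0"] exI[of _ ?v] conjI covered_nbhd_self[OF x0] openin_covered_nbhd)
qed

lemma injective_nbhd:
  assumes "y \<in> total_space"
  obtains V where "openin cover_top V" "y \<in> V" "inj_on fst V" "open_map (subtopology cover_top V) (topo X) fst"
proof -
  let ?x = "fst y"
  have x: "?x \<in> topspace (topo X)" using fst_total_space[OF assms] .
  define w where "w = root_of y / local_root ?x ?x"
  have w: "w ^ m = f ?x" unfolding w_def using sheet_ratio_power[OF x assms covered_nbhd_self[OF x]] .
  let ?V = "sheet ?x w"
  have h: "homeomorphic_map (subtopology cover_top ?V) (subtopology (topo X) (covered_nbhd ?x)) fst"
    by (rule homeomorphic_sheet[OF x w])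
  have "topspace (subtopology cover_top ?V) = ?V" by (auto simp: sheet_def)
  then have "inj_on fst ?V" using homeomorphic_imp_injective_map[OF h] by simp
  moreover have "open_map (subtopology cover_top ?V) (topo X) fst"
    using homeomorphic_imp_open_map[OF h] openin_trans_full[OF _ openin_covered_nbhd]
    unfolding open_map_def by blast
  moreover have "y \<in> ?V" using assms covered_nbhd_self[OF x] by (simp add: sheet_def w_def)
  ultimately show thesis using that openin_sheet[OF x] by blast
qed

text \<open>Openness is local, and the projection is open on each sheet.\<close>

lemma open_map_fst: "open_map cover_top (topo X) fst"
  unfolding open_map_def
proof (intro allI impI)
  fix O' assume O': "openin cover_top O'"
  show "openin (topo X) (fst ` O')"
  proof (subst openin_subopen, intro ballI)
    fix x assume "x \<in> fst ` O'"
    then obtain y where y: "y \<in> O'" "x = fst y" by blast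
    then have "y \<in> total_space" using openin_subset[OF O'] by auto
    then obtain V where V: "openin cover_top V" "y \<in> V" "open_map (subtopology cover_top V) (topo X) fst"
      by (rule injective_nbhd)
    have "openin (subtopology cover_top V) (O' \<inter> V)"
      using O' by (auto simp: openin_subtopology)
    then have "openin (topo X) (fst ` (O' \<inter> V))" using V(3) unfolding open_map_def by blast
    then show "\<exists>T. openin (topo X) T \<and> x \<in> T \<and> T \<subseteq> fst ` O'"
      using y V(2) by blast
  qed
qed

end

section \<open>The pulled-back hyperbolic structure\<close>

lemma locally_isometricI:
  assumes "continuous_map (topo S) (topo T) f"
    and "\<And>U \<phi> V \<psi> x. (U, \<phi>) \<in> atlas S \<Longrightarrow> (V, \<psi>) \<in> atlas T \<Longrightarrow> x \<in> U \<Longrightarrow> f x \<in> V \<Longrightarrow>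
      \<exists>W g. openin (topo S) W \<and> x \<in> W \<and> W \<subseteq> U \<and> hyp_isometry g \<and> (\<forall>y\<in>W. f y \<in> V \<and> \<psi> (f y) = g (\<phi> y))"
  shows "locally_isometric S T f"
  unfolding locally_isometric_def using assms(1)
  by (intro conjI ballI case_prodI2 impI) (simp_all only: assms(2))

lemma locally_isometric_idD:
  assumes "hyp_surface S" "(U, \<phi>) \<in> atlas S" "(U', \<phi>') \<in> atlas S" "x \<in> U" "x \<in> U'"
  obtains W g where "openin (topo S) W" "x \<in> W" "W \<subseteq> U" "hyp_isometry g"
    "\<And>y. y \<in> W \<Longrightarrow> y \<in> U' \<and> \<phi>' y = g (\<phi> y)"
proof -
  have "\<forall>(U, \<phi>)\<in>atlas S. \<forall>(V, \<psi>)\<in>atlas S. \<forall>x\<in>U. x \<in> V \<longrightarrow>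
        (\<exists>W g. openin (topo S) W \<and> x \<in> W \<and> W \<subseteq> U \<and> hyp_isometry g \<and>
           (\<forall>y\<in>W. y \<in> V \<and> \<psi> y = g (\<phi> y)))"
    using assms(1) unfolding hyp_surface_def locally_isometric_def by (elim conjE)
  from bspec[OF this assms(2), unfolded split] have "\<forall>(V, \<psi>)\<in>atlas S. \<forall>x\<in>U. x \<in> V \<longrightarrow>
        (\<exists>W g. openin (topo S) W \<and> x \<in> W \<and> W \<subseteq> U \<and> hyp_isometry g \<and>
           (\<forall>y\<in>W. y \<in> V \<and> \<psi> y = g (\<phi> y)))" .
  from bspec[OF this assms(3), unfolded split] assms(4,5)
  obtain W g where "openin (topo S) W" "x \<in> W" "W \<subseteq> U" "hyp_isometry g"
    "\<forall>y\<in>W. y \<in> U' \<and> \<phi>' y = g (\<phi> y)" by blast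
  then show thesis by (intro that[of W g]) auto
qed

context cyclic_root_cover
begin

lemma topo_cover_surface [simp]: "topo cover_surface = cover_top"
  by (simp add: cover_surface_def)

lemma atlas_cover_surfaceE:
  assumes "(V, \<psi>) \<in> atlas cover_surface"
  obtains U \<phi> where "(U, \<phi>) \<in> atlas X" "openin cover_top V" "fst ` V \<subseteq> U" "inj_on fst V" "\<psi> = \<phi> \<circ> fst"
  using assms unfolding cover_surface_def by auto

lemma atlas_cover_surfaceI:
  assumes "(U, \<phi>) \<in> atlas X" "openin cover_top V" "fst ` V \<subseteq> U" "inj_on fst V"
  shows "(V, \<phi> \<circ> fst) \<in> atlas cover_surface"
  using assms unfolding cover_surface_def by auto

lemma homeomorphic_map_fst_nbhd:
  assumes V: "openin cover_top V" "inj_on fst V"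
  shows "homeomorphic_map (subtopology cover_top V) (subtopology (topo X) (fst ` V)) fst"
proof -
  have ts: "topspace (subtopology cover_top V) = V" using openin_subset[OF V(1)] by auto
  have VX: "fst ` V \<subseteq> topspace (topo X)"
    using openin_subset[OF V(1)] fst_total_space by auto
  show ?thesis
  proof (rule bijective_open_imp_homeomorphic_map)
    show "continuous_map (subtopology cover_top V) (subtopology (topo X) (fst ` V)) fst"
      using continuous_map_from_subtopology[OF continuous_fst] by (auto simp: continuous_map_in_subtopology)
    show "open_map (subtopology cover_top V) (subtopology (topo X) (fst ` V)) fst"
      by (intro open_map_into_subtopology open_map_from_subtopology open_map_fst V(1)) auto
    show "fst ` topspace (subtopology cover_top V) = topspace (subtopology (topo X) (fst ` V))"
      unfolding ts using VX by auto
    show "inj_on fst (topspace (subtopology cover_top V))" unfolding ts by (rule V(2))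
  qed
qed

text \<open>On an open set where it is injective, the open continuous projection is a homeomorphism onto an open
set, so that a chart of \<open>X\<close> composed with it is a chart.\<close>

lemma half_plane_chart_cover:
  assumes "(V, \<psi>) \<in> atlas cover_surface"
  shows "half_plane_chart cover_top V \<psi>"
proof -
  from assms obtain U \<phi> where U: "(U, \<phi>) \<in> atlas X" and V: "openin cover_top V" "fst ` V \<subseteq> U" "inj_on fst V"
    and \<psi>: "\<psi> = \<phi> \<circ> fst" by (rule atlas_cover_surfaceE)
  note c = half_plane_chartD[OF hyp_surfaceD[OF X U]]
  have ch: "openin (top_of_set hyp_half_plane) (\<phi> ` U)"
    "homeomorphic_map (subtopology (topo X) U) (top_of_set (\<phi> ` U)) \<phi>"
    using hyp_surfaceD[OF X U] unfolding half_plane_chart_def by auto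
  have oV: "openin (topo X) (fst ` V)" using open_map_fst V(1) unfolding open_map_def by blast
  have UX: "U \<subseteq> topspace (topo X)" using openin_subset[OF c(1)] .
  have "homeomorphic_map (subtopology (subtopology (topo X) U) (fst ` V)) (subtopology (top_of_set (\<phi> ` U)) (\<phi> ` fst ` V)) \<phi>"
    by (rule homeomorphic_map_subtopologies[OF ch(2)]) (use UX V(2) in auto)
  moreover have "subtopology (top_of_set (\<phi> ` U)) (\<phi> ` fst ` V) = top_of_set (\<phi> ` fst ` V)"
    "subtopology (subtopology (topo X) U) (fst ` V) = subtopology (topo X) (fst ` V)"
    unfolding subtopology_subtopology using V(2) by (intro arg_cong[where f="subtopology _"]; blast)+
  ultimately have "homeomorphic_map (subtopology (topo X) (fst ` V)) (top_of_set (\<phi> ` fst ` V)) \<phi>" by simp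
  from homeomorphic_map_compose[OF homeomorphic_map_fst_nbhd[OF V(1,3)] this]
  have "homeomorphic_map (subtopology cover_top V) (top_of_set (\<psi> ` V)) \<psi>"
    by (simp add: \<psi> image_comp)
  moreover have "openin (top_of_set hyp_half_plane) (\<psi> ` V)"
    using openin_trans[OF c(5)[OF oV V(2)] ch(1)] by (simp add: \<psi> image_comp)
  ultimately show ?thesis using V(1) unfolding half_plane_chart_def by blast
qed

lemma cover_chart_at:
  assumes "y \<in> total_space" "(U, \<phi>) \<in> atlas X" "fst y \<in> U"
  obtains V where "y \<in> V" "openin cover_top V" "(V, \<phi> \<circ> fst) \<in> atlas cover_surface"
proof -
  obtain V where V: "openin cover_top V" "y \<in> V" "inj_on fst V"
    using injective_nbhd[OF assms(1)] by metis
  let ?V = "V \<inter> {y \<in> topspace cover_top. fst y \<in> U}"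
  have "openin cover_top ?V"
    using half_plane_chartD(1)[OF hyp_surfaceD[OF X assms(2)]]
    by (intro openin_Int V(1) openin_continuous_map_preimage[OF continuous_fst])
  moreover from this have "(?V, \<phi> \<circ> fst) \<in> atlas cover_surface"
    by (intro atlas_cover_surfaceI[OF assms(2)]) (auto intro: inj_on_subset[OF V(3)])
  ultimately show thesis using that[of ?V] V(2) assms by simp
qed

lemma Hausdorff_cover_top: "Hausdorff_space cover_top"
proof (rule Hausdorff_space_injective_preimage)
  show "Hausdorff_space (prod_topology (topo X) (euclidean :: complex topology))"
    using X unfolding hyp_surface_def by (simp add: Hausdorff_space_prod_topology Hausdorff_space_euclidean)
  show "continuous_map cover_top (prod_topology (topo X) euclidean) (\<lambda>y. (fst y, root_of y))"
    by (rule continuous_into_product)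
  show "inj_on (\<lambda>y. (fst y, root_of y)) (topspace cover_top)"
  proof (rule inj_onI)
    fix y y' assume "y \<in> topspace cover_top" "y' \<in> topspace cover_top" "(fst y, root_of y) = (fst y', root_of y')"
    then show "y = y'" by (intro total_space_eqI) simp_all
  qed
qed

text \<open>A base is formed by the preimages of products of basic open sets.\<close>

lemma second_countable_cover_top: "second_countable cover_top"
proof -
  obtain B where B: "countable B" "\<And>V. V \<in> B \<Longrightarrow> openin (topo X) V"
    "\<And>U x. openin (topo X) U \<Longrightarrow> x \<in> U \<Longrightarrow> \<exists>V\<in>B. x \<in> V \<and> V \<subseteq> U"
    using X unfolding hyp_surface_def second_countable_def by metis
  obtain D :: "complex set set" where D: "countable D" "topological_basis D"
    using ex_countable_basis by blast
  define N where "N V W = {y \<in> total_space. fst y \<in> V \<and> root_of y \<in> W}" for V W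
  show ?thesis
    unfolding second_countable_def
  proof (intro exI[of _ "(\<lambda>(V, W). N V W) ` (B \<times> D)"] conjI ballI allI impI)
    show "countable ((\<lambda>(V, W). N V W) ` (B \<times> D))" using B(1) D(1) by blast
    fix S assume "S \<in> (\<lambda>(V, W). N V W) ` (B \<times> D)"
    then obtain V W where VW: "V \<in> B" "W \<in> D" "S = N V W" by auto
    have "S = {y \<in> topspace cover_top. fst y \<in> V} \<inter> {y \<in> topspace cover_top. root_of y \<in> W}"
      unfolding VW(3) N_def by auto
    then show "openin cover_top S"
      using openin_continuous_map_preimage[OF continuous_fst B(2)[OF VW(1)]]
        openin_continuous_map_preimage[OF continuous_root_of, of W] topological_basis_open[OF D(2) VW(2)]
      by (simp add: openin_Int)
  next
    fix S y assume S: "openin cover_top S \<and> y \<in> S"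
    then obtain O' where O': "openin (prod_topology (topo X) euclidean) O'" 
      "S = (\<lambda>y. (fst y, root_of y)) -` O' \<inter> total_space"
      unfolding cover_top_def openin_pullback_topology by blast
    then have "(fst y, root_of y) \<in> O'" using S by blast
    then obtain V W where VW: "openin (topo X) V" "open W" "fst y \<in> V" "root_of y \<in> W" "V \<times> W \<subseteq> O'"
      using O'(1) unfolding openin_prod_topology_alt by (metis open_openin)
    obtain V' where V': "V' \<in> B" "fst y \<in> V'" "V' \<subseteq> V" using B(3)[OF VW(1,3)] by blast
    obtain W' where W': "W' \<in> D" "root_of y \<in> W'" "W' \<subseteq> W" using topological_basisE[OF D(2) VW(2,4)] .
    have "y \<in> N V' W'" using O'(2) S V' W' by (simp add: N_def)
    moreover have "N V' W' \<subseteq> S" unfolding O'(2) N_def using V' W' VW(5) by blast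
    ultimately show "\<exists>V\<in>(\<lambda>(V, W). N V W) ` (B \<times> D). y \<in> V \<and> V \<subseteq> S"
      using V' W' by blast
  qed
qed

lemma locally_isometric_fst: "locally_isometric cover_surface X fst"
proof (rule locally_isometricI)
  show "continuous_map (topo cover_surface) (topo X) fst" using continuous_fst by simp
  fix V \<psi> U' \<phi>' y
  assume V\<psi>: "(V, \<psi>) \<in> atlas cover_surface" and U': "(U', \<phi>') \<in> atlas X" and y: "y \<in> V" "fst y \<in> U'"
  obtain U \<phi> where U: "(U, \<phi>) \<in> atlas X" and V: "openin cover_top V" "fst ` V \<subseteq> U" "inj_on fst V"
    and \<psi>: "\<psi> = \<phi> \<circ> fst" using V\<psi> by (rule atlas_cover_surfaceE)
  show "\<exists>W g. openin (topo cover_surface) W \<and> y \<in> W \<and> W \<subseteq> V \<and> hyp_isometry g \<and>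
           (\<forall>z\<in>W. fst z \<in> U' \<and> \<phi>' (fst z) = g (\<psi> z))"
  proof -
    have "fst y \<in> U" using V(2) y(1) by blast
    then obtain W g where W: "openin (topo X) W" "fst y \<in> W" "W \<subseteq> U" "hyp_isometry g"
        "\<And>x. x \<in> W \<Longrightarrow> x \<in> U' \<and> \<phi>' x = g (\<phi> x)"
      using locally_isometric_idD[OF X U U' _ y(2)] by metis
    have yt: "y \<in> topspace cover_top" using y(1) openin_subset[OF V(1)] by blast
    show ?thesis
      by (intro exI[of _ "V \<inter> {y \<in> topspace cover_top. fst y \<in> W}"] exI[of _ g])
        (use W y yt V(1) openin_continuous_map_preimage[OF continuous_fst W(1)] in \<open>auto simp: \<psi>\<close>)
  qed
qed

lemma locally_isometric_cover_id: "locally_isometric cover_surface cover_surface (\<lambda>y. y)"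
proof (rule locally_isometricI)
  show "continuous_map (topo cover_surface) (topo cover_surface) (\<lambda>y. y)" by simp
  fix V \<psi> V' \<psi>' y
  assume V\<psi>: "(V, \<psi>) \<in> atlas cover_surface" and V\<psi>': "(V', \<psi>') \<in> atlas cover_surface"
    and y: "y \<in> V" "y \<in> V'"
  obtain U \<phi> where U: "(U, \<phi>) \<in> atlas X" and V: "openin cover_top V" "fst ` V \<subseteq> U" "inj_on fst V"
    and \<psi>: "\<psi> = \<phi> \<circ> fst" using V\<psi> by (rule atlas_cover_surfaceE)
  obtain U' \<phi>' where U': "(U', \<phi>') \<in> atlas X" and V': "openin cover_top V'" "fst ` V' \<subseteq> U'" "inj_on fst V'"
    and \<psi>': "\<psi>' = \<phi>' \<circ> fst" using V\<psi>' by (rule atlas_cover_surfaceE)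
  show "\<exists>W g. openin (topo cover_surface) W \<and> y \<in> W \<and> W \<subseteq> V \<and> hyp_isometry g \<and>
           (\<forall>z\<in>W. z \<in> V' \<and> \<psi>' z = g (\<psi> z))"
  proof -
    have "fst y \<in> U" "fst y \<in> U'" using V(2) V'(2) y by blast+
    then obtain W g where W: "openin (topo X) W" "fst y \<in> W" "W \<subseteq> U" "hyp_isometry g"
        "\<And>x. x \<in> W \<Longrightarrow> x \<in> U' \<and> \<phi>' x = g (\<phi> x)"
      using locally_isometric_idD[OF X U U'] by metis
    have yt: "y \<in> topspace cover_top" using y(1) openin_subset[OF V(1)] by blast
    show ?thesis
      by (intro exI[of _ "V \<inter> V' \<inter> {y \<in> topspace cover_top. fst y \<in> W}"] exI[of _ g])
        (use W y yt V(1) V'(1) openin_continuous_map_preimage[OF continuous_fst W(1)] in \<open>auto simp: \<psi> \<psi>'\<close>)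
  qed
qed

lemma hyp_surface_cover: "hyp_surface cover_surface"
proof -
  have "(\<Union>(V, \<psi>)\<in>atlas cover_surface. V) = topspace (topo cover_surface)"
  proof
    show "(\<Union>(V, \<psi>)\<in>atlas cover_surface. V) \<subseteq> topspace (topo cover_surface)"
      using openin_subset by (fastforce elim!: atlas_cover_surfaceE)
    show "topspace (topo cover_surface) \<subseteq> (\<Union>(V, \<psi>)\<in>atlas cover_surface. V)"
    proof
      fix y assume "y \<in> topspace (topo cover_surface)"
      then have y: "y \<in> total_space" by simp
      have "fst y \<in> (\<Union>(U, \<phi>)\<in>atlas X. U)"
        using X fst_total_space[OF y] unfolding hyp_surface_def by simp
      then obtain U \<phi> where "(U, \<phi>) \<in> atlas X" "fst y \<in> U" by auto
      then obtain V where "y \<in> V" "(V, \<phi> \<circ> fst) \<in> atlas cover_surface"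
        using cover_chart_at[OF y] by metis
      then show "y \<in> (\<Union>(V, \<psi>)\<in>atlas cover_surface. V)" by blast
    qed
  qed
  then show ?thesis
    unfolding hyp_surface_def
    using Hausdorff_cover_top second_countable_cover_top half_plane_chart_cover locally_isometric_cover_id
    by auto
qed

section \<open>Deck transformations of the root cover\<close>

text \<open>Deck transformations must be undefined outside of the total space for the deck group to be a group of
extensional functions; hence the restriction.\<close>

definition rotation :: "complex \<Rightarrow> 'a \<times> nat \<Rightarrow> 'a \<times> nat" where
  "rotation \<zeta> = (\<lambda>y\<in>total_space. point_over (fst y) (\<zeta> * root_of y))"

context
  fixes \<zeta> :: complex
  assumes \<zeta>: "\<zeta> ^ m = 1"
begin

lemma rotated_root_power: "y \<in> total_space \<Longrightarrow> (\<zeta> * root_of y) ^ m = f (fst y)"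
  using \<zeta> by (simp add: power_mult_distrib root_of_power)

lemma rotation_in: "y \<in> total_space \<Longrightarrow> rotation \<zeta> y \<in> total_space"
  by (simp add: rotation_def point_over_in fst_total_space rotated_root_power)

lemma fst_rotation: "y \<in> total_space \<Longrightarrow> fst (rotation \<zeta> y) = fst y"
  by (simp add: rotation_def)

lemma root_of_rotation: "y \<in> total_space \<Longrightarrow> root_of (rotation \<zeta> y) = \<zeta> * root_of y"
  by (simp add: rotation_def root_of_point_over fst_total_space rotated_root_power)

lemma continuous_rotation: "continuous_map cover_top cover_top (rotation \<zeta>)"
proof (rule continuous_map_eq)
  show "continuous_map cover_top cover_top (\<lambda>y. point_over (fst y) (\<zeta> * root_of y))"
  proof (rule continuous_point_over)
    show "continuous_map cover_top euclidean (\<lambda>y. \<zeta> * root_of y)"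
      by (intro continuous_map_complex_compose2[where g="\<lambda>_. \<zeta>" and h="(*)" and S=UNIV]
        continuous_root_of continuous_intros) auto
  qed (use continuous_fst rotated_root_power in auto)
qed (simp add: rotation_def)

end

lemma rotation_mult:
  assumes "\<zeta> ^ m = 1" "\<xi> ^ m = 1" "y \<in> total_space"
  shows "rotation \<zeta> (rotation \<xi> y) = rotation (\<zeta> * \<xi>) y"
proof (rule total_space_eqI)
  have "(\<zeta> * \<xi>) ^ m = 1" using assms by (simp add: power_mult_distrib)
  then show "rotation (\<zeta> * \<xi>) y \<in> total_space" "fst (rotation \<zeta> (rotation \<xi> y)) = fst (rotation (\<zeta> * \<xi>) y)"
    "root_of (rotation \<zeta> (rotation \<xi> y)) = root_of (rotation (\<zeta> * \<xi>) y)"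
    using assms by (simp_all add: rotation_in fst_rotation root_of_rotation)
qed (use assms in \<open>simp add: rotation_in\<close>)

lemma rotation_one: "y \<in> total_space \<Longrightarrow> rotation 1 y = y"
  by (simp add: rotation_def point_over_root_of)

lemma homeomorphic_rotation:
  assumes "\<zeta> ^ m = 1"
  shows "homeomorphic_map cover_top cover_top (rotation \<zeta>)"
proof -
  have i: "(1 / \<zeta>) ^ m = 1" using assms by (simp add: power_divide)
  have "\<zeta> \<noteq> 0" using assms m_pos by (auto simp: power_0_left)
  then have "homeomorphic_maps cover_top cover_top (rotation \<zeta>) (rotation (1 / \<zeta>))"
    unfolding homeomorphic_maps_def
    using continuous_rotation[OF assms] continuous_rotation[OF i]
      rotation_mult[OF assms i] rotation_mult[OF i assms] rotation_one by simp
  then show ?thesis by (rule homeomorphic_maps_map[THEN iffD1, THEN conjunct1])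
qed

lemma rotation_deck: "\<zeta> ^ m = 1 \<Longrightarrow> rotation \<zeta> \<in> deck_transformations cover_top fst"
  unfolding deck_transformations_def
  using homeomorphic_rotation fst_rotation by (auto simp: rotation_def)

text \<open>The quotient of two \<open>m\<close>-th roots of the same number is a root of unity.\<close>

lemma same_fibre_rotation:
  assumes "y \<in> total_space" "y' \<in> total_space" "fst y = fst y'"
  obtains \<zeta> where "\<zeta> ^ m = 1" "rotation \<zeta> y = y'"
proof
  have nz: "f (fst y') \<noteq> 0" using f_nz[OF fst_total_space[OF assms(2)]] .
  show 1: "(root_of y' / root_of y) ^ m = 1"
    using assms nz by (simp add: power_divide root_of_power)
  show "rotation (root_of y' / root_of y) y = y'"
    using assms 1 root_of_nz by (intro total_space_eqI) (simp_all add: rotation_in fst_rotation root_of_rotation)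
qed

lemma regular_cover_fst: "regular_cover cover_top fst"
  unfolding regular_cover_def
proof (intro ballI impI)
  fix y y' assume "y \<in> topspace cover_top" "y' \<in> topspace cover_top" "fst y = fst y'"
  then obtain \<zeta> where "\<zeta> ^ m = 1" "rotation \<zeta> y = y'" using same_fibre_rotation[of y y'] by auto
  then show "\<exists>h\<in>deck_transformations cover_top fst. h y = y'" using rotation_deck by blast
qed

text \<open>The quotient of two continuous choices of roots takes finitely many values on a connected space. Applied to the
cover itself it determines the deck group, and applied to the line it is uniqueness of lifts of curves.\<close>

lemma continuous_same_fibre_roots:
  fixes g w :: "'z \<Rightarrow> complex"
  assumes con: "connected_space Z" and g: "continuous_map Z euclidean g" and w: "continuous_map Z euclidean w"
    and pw: "\<And>z. z \<in> topspace Z \<Longrightarrow> g z ^ m = w z ^ m" and nz: "\<And>z. z \<in> topspace Z \<Longrightarrow> w z \<noteq> 0"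
  obtains \<zeta> where "\<zeta> ^ m = 1" "\<And>z. z \<in> topspace Z \<Longrightarrow> g z = \<zeta> * w z"
proof -
  let ?r = "\<lambda>z. g z / w z"
  have "continuous_map Z euclidean ?r"
    by (intro continuous_map_complex_compose2[where h="(/)" and S="UNIV \<times> (-{0})"] g w continuous_intros)
      (use nz in auto)
  then have "connectedin euclidean (?r ` topspace Z)"
    using con connectedin_continuous_map_image connectedin_topspace by metis
  then have "connected (?r ` topspace Z)" by simp
  moreover have "?r ` topspace Z \<subseteq> {\<zeta>. \<zeta> ^ m = 1}"
    using pw nz by (auto simp: power_divide)
  moreover have "finite {\<zeta>::complex. \<zeta> ^ m = 1}" using m_pos by (rule finite_nth_roots)
  ultimately have *: "?r ` topspace Z = {} \<or> (\<exists>\<zeta>. ?r ` topspace Z = {\<zeta>})"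
    "?r ` topspace Z \<subseteq> {\<zeta>. \<zeta> ^ m = 1}"
    using connected_finite_iff_sing finite_subset by blast+
  show thesis
  proof (cases "topspace Z = {}")
    case True
    then show ?thesis using that[of 1] by simp
  next
    case False
    then obtain \<zeta> where "?r ` topspace Z = {\<zeta>}" using * by auto
    then have "g z / w z = \<zeta>" if "z \<in> topspace Z" for z using that by blast
    then have "g z = \<zeta> * w z" if "z \<in> topspace Z" for z using that nz by (metis nonzero_eq_divide_eq)
    moreover have "\<zeta> ^ m = 1" using * \<open>?r ` topspace Z = {\<zeta>}\<close> by simp
    ultimately show ?thesis using that by blast
  qed
qed

text \<open>For a deck transformation \<open>h\<close> both \<open>root_of \<circ> h\<close> and \<open>root_of\<close> are continuous roots of \<open>f \<circ> fst\<close>, so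
they differ by a constant root of unity.\<close>

lemma deck_transformations_eq:
  assumes con: "connected_space cover_top"
  shows "deck_transformations cover_top fst = rotation ` {\<zeta>. \<zeta> ^ m = 1}"
proof
  show "rotation ` {\<zeta>. \<zeta> ^ m = 1} \<subseteq> deck_transformations cover_top fst"
    using rotation_deck by blast
  show "deck_transformations cover_top fst \<subseteq> rotation ` {\<zeta>. \<zeta> ^ m = 1}"
  proof
    fix h assume "h \<in> deck_transformations cover_top fst"
    then have ext: "h \<in> extensional total_space" and hom: "homeomorphic_map cover_top cover_top h"
      and fib: "\<And>y. y \<in> total_space \<Longrightarrow> fst (h y) = fst y"
      unfolding deck_transformations_def by auto
    have hc: "continuous_map cover_top cover_top h" using homeomorphic_imp_continuous_map[OF hom] .
    have ht: "h y \<in> total_space" if "y \<in> total_space" for y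
      using homeomorphic_imp_surjective_map[OF hom] that by auto
    have "continuous_map cover_top euclidean (\<lambda>y. root_of (h y))"
      using continuous_map_compose[OF hc continuous_root_of] by (simp add: o_def)
    then obtain \<zeta> where z: "\<zeta> ^ m = 1" "\<And>y. y \<in> topspace cover_top \<Longrightarrow> root_of (h y) = \<zeta> * root_of y"
      by (rule continuous_same_fibre_roots[OF con _ continuous_root_of])
        (simp_all add: root_of_power ht fib root_of_nz)
    have "h = rotation \<zeta>"
    proof (rule extensionalityI[OF ext])
      show "rotation \<zeta> \<in> extensional total_space" by (simp add: rotation_def)
      fix y assume y: "y \<in> total_space"
      show "h y = rotation \<zeta> y"
        using y z ht fib by (intro total_space_eqI) (simp_all add: rotation_in fst_rotation root_of_rotation)
    qed
    then show "h \<in> rotation ` {\<zeta>. \<zeta> ^ m = 1}" using z by blast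
  qed
qed

text \<open>The deck group is isomorphic to the group of \<open>m\<close>-th roots of unity.\<close>

lemma cyclic_deck_group:
  assumes con: "connected_space cover_top"
  shows "cyclic_group (deck_group cover_top fst)"
proof -
  let ?G = "deck_group cover_top fst" and ?R = "{\<zeta>::complex. \<zeta> ^ m = 1}"
  have car: "carrier ?G = rotation ` ?R"
    using deck_transformations_eq[OF con] by (simp add: deck_group_def)
  have bij: "rotation \<zeta> \<in> Bij total_space" if "\<zeta> ^ m = 1" for \<zeta>
  proof -
    note h = homeomorphic_rotation[OF that]
    have "bij_betw (rotation \<zeta>) total_space total_space"
      using homeomorphic_imp_injective_map[OF h] homeomorphic_imp_surjective_map[OF h]
      by (simp add: bij_betw_def)
    then show ?thesis by (simp add: Bij_def rotation_def)
  qed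
  have mult: "rotation \<zeta> \<otimes>\<^bsub>?G\<^esub> rotation \<xi> = rotation (\<zeta> * \<xi>)" if "\<zeta> ^ m = 1" "\<xi> ^ m = 1" for \<zeta> \<xi>
  proof -
    have "rotation \<zeta> \<otimes>\<^bsub>?G\<^esub> rotation \<xi> = compose total_space (rotation \<zeta>) (rotation \<xi>)"
      using bij that by (simp add: deck_group_def BijGroup_def)
    also have "\<dots> = rotation (\<zeta> * \<xi>)"
    proof (rule extensionalityI[where A=total_space])
      show "rotation (\<zeta> * \<xi>) \<in> extensional total_space" by (simp add: rotation_def)
      show "compose total_space (rotation \<zeta>) (rotation \<xi>) y = rotation (\<zeta> * \<xi>) y" if "y \<in> total_space" for y
        using that rotation_mult \<open>\<zeta> ^ m = 1\<close> \<open>\<xi> ^ m = 1\<close> by (simp add: compose_def)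
    qed (simp add: compose_extensional)
    finally show ?thesis .
  qed
  have one: "\<one>\<^bsub>?G\<^esub> = rotation 1"
  proof -
    have "\<one>\<^bsub>?G\<^esub> = (\<lambda>y\<in>total_space. y)" by (simp add: deck_group_def BijGroup_def)
    also have "\<dots> = rotation 1"
      by (rule extensionalityI[where A=total_space]) (simp_all add: rotation_one, simp add: rotation_def)
    finally show ?thesis .
  qed
  have carI: "rotation \<zeta> \<in> carrier ?G" if "\<zeta> ^ m = 1" for \<zeta>
    using that car by blast
  have carE: "\<exists>\<zeta>. \<zeta> ^ m = 1 \<and> g = rotation \<zeta>" if "g \<in> carrier ?G" for g
    using that car by blast
  have prod: "(\<zeta> * \<xi>) ^ m = 1" if "\<zeta> ^ m = 1" "\<xi> ^ m = 1" for \<zeta> \<xi> :: complex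
    using that by (simp add: power_mult_distrib)
  interpret G: group ?G
  proof (rule groupI)
    show "\<one>\<^bsub>?G\<^esub> \<in> carrier ?G" unfolding one by (rule carI) simp
  next
    fix g h assume "g \<in> carrier ?G" "h \<in> carrier ?G"
    then obtain \<zeta> \<xi> where z: "\<zeta> ^ m = 1" "\<xi> ^ m = 1" "g = rotation \<zeta>" "h = rotation \<xi>"
      using carE by metis
    show "g \<otimes>\<^bsub>?G\<^esub> h \<in> carrier ?G"
      unfolding z(3,4) mult[OF z(1,2)] by (rule carI[OF prod[OF z(1,2)]])
  next
    fix g h l assume "g \<in> carrier ?G" "h \<in> carrier ?G" "l \<in> carrier ?G"
    then obtain \<zeta> \<xi> \<eta> where z: "\<zeta> ^ m = 1" "\<xi> ^ m = 1" "\<eta> ^ m = 1"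
      and g: "g = rotation \<zeta>" "h = rotation \<xi>" "l = rotation \<eta>"
      using carE by metis
    show "g \<otimes>\<^bsub>?G\<^esub> h \<otimes>\<^bsub>?G\<^esub> l = g \<otimes>\<^bsub>?G\<^esub> (h \<otimes>\<^bsub>?G\<^esub> l)"
      unfolding g mult[OF z(1,2)] mult[OF z(2,3)] mult[OF prod[OF z(1,2)] z(3)]
        mult[OF z(1) prod[OF z(2,3)]] by (simp only: mult.assoc)
  next
    fix g assume "g \<in> carrier ?G"
    then obtain \<zeta> where z: "\<zeta> ^ m = 1" and g: "g = rotation \<zeta>" using carE by metis
    show "\<one>\<^bsub>?G\<^esub> \<otimes>\<^bsub>?G\<^esub> g = g" unfolding g one mult[OF power_one z] by simp
    have i: "(1 / \<zeta>) ^ m = 1" using z by (simp add: power_divide)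
    have "\<zeta> \<noteq> 0" using z m_pos by (auto simp: power_0_left)
    then have "rotation (1 / \<zeta>) \<otimes>\<^bsub>?G\<^esub> g = \<one>\<^bsub>?G\<^esub>"
      unfolding g one mult[OF i z] by simp
    then show "\<exists>h\<in>carrier ?G. h \<otimes>\<^bsub>?G\<^esub> g = \<one>\<^bsub>?G\<^esub>" using carI[OF i] by blast
  qed
  define \<omega> where "\<omega> = cis (2 * pi / real m)"
  have om: "\<omega> ^ m = 1" using cis_root_power[of 1] by (simp add: \<omega>_def)
  have pow: "rotation \<omega> [^]\<^bsub>?G\<^esub> (n::nat) = rotation (\<omega> ^ n)" for n
  proof (induction n)
    case (Suc n)
    have "(\<omega> ^ n) ^ m = 1" using om by (metis power_mult power_one mult.commute)
    then show ?case
      unfolding G.nat_pow_Suc Suc by (simp only: mult[OF _ om] power_Suc2)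
  qed (simp add: one)
  have "carrier ?G = range (\<lambda>n::int. rotation \<omega> [^]\<^bsub>?G\<^esub> n)"
  proof
    show "carrier ?G \<subseteq> range (\<lambda>n::int. rotation \<omega> [^]\<^bsub>?G\<^esub> n)"
    proof
      fix g assume "g \<in> carrier ?G"
      then obtain \<zeta> where z: "\<zeta> ^ m = 1" "g = rotation \<zeta>" using carE by metis
      then obtain j :: nat where "\<zeta> = cis (2 * pi * real j / real m)" using roots_of_unity by blast
      then have "\<zeta> = \<omega> ^ j" by (simp add: \<omega>_def Complex.DeMoivre mult_ac)
      then have "g = rotation \<omega> [^]\<^bsub>?G\<^esub> (int j)" using pow[of j] z(2) by (simp add: int_pow_int)
      then show "g \<in> range (\<lambda>n::int. rotation \<omega> [^]\<^bsub>?G\<^esub> n)" by blast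
    qed
    show "range (\<lambda>n::int. rotation \<omega> [^]\<^bsub>?G\<^esub> n) \<subseteq> carrier ?G"
      using G.int_pow_closed[OF carI[OF om]] by blast
  qed
  then show ?thesis using carI[OF om] unfolding G.cyclic_group by blast
qed

end

section \<open>Unwrapping a closed geodesic\<close>

text \<open>The last two assumptions say that \<open>f\<close> has degree one along \<open>\<alpha>\<close>, by means of a logarithm \<open>u\<close> of \<open>f \<circ> \<alpha>\<close>.\<close>

locale geodesic_unwrapping = cyclic_root_cover X f m
  for X :: "'a hyp_surface" and f :: "'a \<Rightarrow> complex" and m :: nat +
  fixes \<alpha> :: "real \<Rightarrow> 'a" and a :: real and u :: "real \<Rightarrow> complex"
  assumes connected_X: "connected_space (topo X)"
    and geodesic: "closed_geodesic X \<alpha> a"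
    and u_cont: "continuous_on UNIV u"
    and u_log: "f (\<alpha> t) = exp (u t)"
    and u_period: "u (t + a) = u t + 2 * pi * \<i>"
begin

lemma a_pos: "a > 0" and \<alpha>_period: "\<alpha> (t + a) = \<alpha> t"
  using geodesic unfolding closed_geodesic_def by auto

lemma \<alpha>_cont: "continuous_map euclideanreal (topo X) \<alpha>"
  by (rule closed_geodesic_continuous[OF X geodesic])

lemma \<alpha>_in: "\<alpha> t \<in> topspace (topo X)"
  using \<alpha>_cont by (auto simp: continuous_map_def)

lemma \<alpha>_period_mult: "\<alpha> (t + real j * a) = \<alpha> t"
  using periodic_add_int_mult[of \<alpha> a t "int j", OF \<alpha>_period] by simp

lemma u_period_mult: "u (t + real j * a) = u t + 2 * pi * \<i> * of_nat j"
proof (induction j)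
  case (Suc j)
  have "u (t + real (Suc j) * a) = u (t + real j * a + a)" by (simp add: algebra_simps)
  also have "\<dots> = u t + 2 * pi * \<i> * of_nat j + 2 * pi * \<i>" unfolding u_period Suc ..
  finally show ?case by (simp add: algebra_simps)
qed simp

definition root_along :: "real \<Rightarrow> complex" where
  "root_along t = exp (u t / of_nat m)"

definition lifted_curve :: "real \<Rightarrow> 'a \<times> nat" where
  "lifted_curve t = point_over (\<alpha> t) (root_along t)"

lemma root_along_power: "root_along t ^ m = f (\<alpha> t)"
  using m_pos by (simp add: root_along_def u_log flip: exp_of_nat_mult)

lemma root_along_cont: "continuous_on UNIV root_along"
  unfolding root_along_def using m_pos by (intro continuous_intros u_cont) auto

text \<open>Going \<open>j\<close> times around \<open>\<alpha>\<close> multiplies the root by the \<open>j\<close>-th power of a primitive root of unity. This is where the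
degree of \<open>f\<close> along \<open>\<alpha>\<close> enters.\<close>

lemma root_along_shift: "root_along (t + real j * a) = root_along t * cis (2 * pi * real j / real m)"
proof -
  have "root_along (t + real j * a) = exp (u t / of_nat m + 2 * pi * \<i> * of_nat j / of_nat m)"
    by (simp add: root_along_def u_period_mult add_divide_distrib)
  then show ?thesis by (simp add: root_along_def exp_add cis_conv_exp mult_ac)
qed

lemma lifted_curve_in: "lifted_curve t \<in> total_space"
  and fst_lifted_curve: "fst (lifted_curve t) = \<alpha> t"
  and root_of_lifted_curve: "root_of (lifted_curve t) = root_along t"
  unfolding lifted_curve_def
  by (simp_all add: point_over_in root_of_point_over \<alpha>_in root_along_power)

lemma lifted_curve_cont: "continuous_map euclideanreal cover_top lifted_curve"
  unfolding lifted_curve_def[abs_def]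
  by (rule continuous_point_over) (use \<alpha>_cont root_along_cont root_along_power in auto)

text \<open>The powers of a primitive root of unity are all roots of unity, so that successive turns around \<open>\<alpha>\<close> visit every
point of the fibre.\<close>

lemma fibre_in_lifted_curve:
  assumes "y \<in> total_space" "fst y = \<alpha> 0"
  shows "y \<in> range lifted_curve"
proof -
  have "lifted_curve 0 \<in> total_space" "fst (lifted_curve 0) = fst y"
    using assms lifted_curve_in fst_lifted_curve by auto
  then obtain \<zeta> where z: "\<zeta> ^ m = 1" "rotation \<zeta> (lifted_curve 0) = y"
    using same_fibre_rotation[OF _ assms(1)] by metis
  then obtain j where j: "\<zeta> = cis (2 * pi * real j / real m)" using roots_of_unity by blast
  have "y = lifted_curve (0 + real j * a)"
  proof (rule total_space_eqI)
    show "fst y = fst (lifted_curve (0 + real j * a))"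
      unfolding fst_lifted_curve \<alpha>_period_mult by (rule assms(2))
    have "root_of y = \<zeta> * root_along 0"
      using root_of_rotation[OF z(1) lifted_curve_in[of 0]] unfolding z(2) root_of_lifted_curve .
    then show "root_of y = root_of (lifted_curve (0 + real j * a))"
      unfolding root_of_lifted_curve root_along_shift by (simp add: j mult.commute)
  qed (use assms lifted_curve_in in auto)
  then show ?thesis by blast
qed

text \<open>The image of \<open>B\<close> in \<open>X\<close> is open because the projection is open. It is also closed: the union of the rotated
copies of \<open>B\<close> is closed and saturated, and the image of its complement is the complement of the image of
\<open>B\<close>. Since the image misses \<open>\<alpha> 0\<close>, over which all points lie on the lifted curve, connectedness of \<open>X\<close>
leaves only the empty set.\<close>

lemma clopen_off_lifted_curve_empty:
  assumes B: "openin cover_top B" "closedin cover_top B" and disj: "B \<inter> range lifted_curve = {}"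
  shows "B = {}"
proof -
  let ?R = "{\<zeta>::complex. \<zeta> ^ m = 1}"
  define B' where "B' = (\<Union>\<zeta>\<in>?R. rotation \<zeta> ` B)"
  have Bt: "B \<subseteq> total_space" using openin_subset[OF B(1)] by simp
  have "finite ?R" using m_pos by (rule finite_nth_roots)
  moreover have "closedin cover_top (rotation \<zeta> ` B)" if "\<zeta> ^ m = 1" for \<zeta>
    using homeomorphic_map_closedness_eq[OF homeomorphic_rotation[OF that], of B] B(2) by blast
  ultimately have "closedin cover_top B'"
    unfolding B'_def by (intro closedin_Union) blast+
  then have "openin (topo X) (fst ` (topspace cover_top - B'))"
    using open_map_fst unfolding open_map_def by blast
  moreover have "fst ` (topspace cover_top - B') = topspace (topo X) - fst ` B"
  proof
    show "fst ` (topspace cover_top - B') \<subseteq> topspace (topo X) - fst ` B"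
    proof (rule image_subsetI)
      fix y assume "y \<in> topspace cover_top - B'"
      then have y: "y \<in> total_space" "y \<notin> B'" by simp_all
      have "fst y \<notin> fst ` B"
      proof
        assume "fst y \<in> fst ` B"
        then obtain b where b: "b \<in> B" "fst b = fst y" by (metis imageE)
        then obtain \<zeta> where "\<zeta> ^ m = 1" "rotation \<zeta> b = y"
          using same_fibre_rotation[of b y] y(1) Bt by blast
        then show False using y(2) b(1) unfolding B'_def by blast
      qed
      then show "fst y \<in> topspace (topo X) - fst ` B"
        using fst_total_space[OF y(1)] by simp
    qed
    show "topspace (topo X) - fst ` B \<subseteq> fst ` (topspace cover_top - B')"
    proof
      fix x assume x: "x \<in> topspace (topo X) - fst ` B"
      define y where "y = (x, 0::nat)"
      have y: "y \<in> total_space" "fst y = x" using x m_pos by (simp_all add: y_def total_space_def)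
      have "y \<notin> B'"
      proof
        assume "y \<in> B'"
        then obtain \<zeta> b where b: "\<zeta> ^ m = 1" "b \<in> B" "y = rotation \<zeta> b" unfolding B'_def by blast
        then have "fst y = fst b" using fst_rotation[OF b(1)] Bt by blast
        then show False using x y(2) b(2) by blast
      qed
      then have "y \<in> topspace cover_top - B'" using y(1) by simp
      then show "x \<in> fst ` (topspace cover_top - B')" using y(2) by (metis imageI)
    qed
  qed
  moreover have BX: "fst ` B \<subseteq> topspace (topo X)" using Bt fst_total_space by blast
  ultimately have "closedin (topo X) (fst ` B)"
    unfolding closedin_def by metis
  moreover have "openin (topo X) (fst ` B)"
    using open_map_fst B(1) unfolding open_map_def by blast
  ultimately have "fst ` B = {} \<or> fst ` B = topspace (topo X)"
    using connected_X unfolding connected_space_clopen_in by blast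
  moreover have "\<alpha> 0 \<notin> fst ` B"
  proof
    assume "\<alpha> 0 \<in> fst ` B"
    then obtain b where "b \<in> B" "fst b = \<alpha> 0" by (metis imageE)
    then show False using fibre_in_lifted_curve[of b] disj Bt by blast
  qed
  ultimately show ?thesis using \<alpha>_in[of 0] by blast
qed

text \<open>The lifted curve is connected, so it lies in one of any two complementary clopen sets and misses the other.\<close>

lemma connected_cover: "connected_space cover_top"
  unfolding connected_space_clopen_in
proof (intro allI impI)
  fix T assume T: "openin cover_top T \<and> closedin cover_top T"
  let ?C = "topspace cover_top - T"
  have C: "openin cover_top ?C" "closedin cover_top ?C" using T by (meson closedin_diff closedin_topspace openin_diff openin_topspace)+
  have "connectedin cover_top (range lifted_curve)"
    using connectedin_continuous_map_image[OF lifted_curve_cont, of UNIV] by simp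
  then have "range lifted_curve \<subseteq> T \<or> T \<inter> range lifted_curve = {}"
    using T connectedin_clopen_cases by (metis disjnt_def inf_commute)
  then show "T = {} \<or> T = topspace cover_top"
  proof
    assume "range lifted_curve \<subseteq> T"
    then have "?C = {}" using clopen_off_lifted_curve_empty[OF C] by blast
    then show ?thesis using T closedin_subset by blast
  next
    assume "T \<inter> range lifted_curve = {}"
    then show ?thesis using clopen_off_lifted_curve_empty T by blast
  qed
qed

lemma cyclic_cover_surface: "cyclic_cover cover_surface X fst"
  unfolding cyclic_cover_def hyp_cover_def topo_cover_surface
  using hyp_surface_cover connected_cover covering_map_fst locally_isometric_fst regular_cover_fst
    cyclic_deck_group[OF connected_cover] by blast

text \<open>The lift closes up after \<open>m\<close> turns, and near each of its points the charts of the cover see the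
projected curve \<open>\<alpha>\<close>.\<close>

lemma lifted_curve_geodesic: "closed_geodesic cover_surface lifted_curve (real m * a)"
  unfolding closed_geodesic_def
proof (intro conjI allI)
  show "real m * a > 0" using m_pos a_pos by simp
  show "lifted_curve (t + real m * a) = lifted_curve t" for t
    using m_pos unfolding lifted_curve_def \<alpha>_period_mult root_along_shift by simp
  fix t
  obtain \<epsilon> U \<phi> where \<epsilon>: "\<epsilon> > 0" and U: "(U, \<phi>) \<in> atlas X" and \<alpha>U: "\<alpha> ` {t-\<epsilon><..<t+\<epsilon>} \<subseteq> U"
    and d: "\<And>r s. r \<in> {t-\<epsilon><..<t+\<epsilon>} \<Longrightarrow> s \<in> {t-\<epsilon><..<t+\<epsilon>} \<Longrightarrow>
       hyp_dist (\<phi> (\<alpha> r)) (\<phi> (\<alpha> s)) = \<bar>r - s\<bar>"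
    by (rule closed_geodesic_chart[OF geodesic, of t]) blast
  have "\<alpha> t \<in> U" using \<alpha>U \<epsilon> by auto
  then obtain V where V: "lifted_curve t \<in> V" "openin cover_top V" "(V, \<phi> \<circ> fst) \<in> atlas cover_surface"
    using cover_chart_at[OF lifted_curve_in U] fst_lifted_curve by metis
  have "openin euclideanreal {s \<in> topspace euclideanreal. lifted_curve s \<in> V}"
    by (rule openin_continuous_map_preimage[OF lifted_curve_cont V(2)])
  then have "open {s. lifted_curve s \<in> V}" by simp
  then obtain \<delta> where \<delta>: "\<delta> > 0" "ball t \<delta> \<subseteq> {s. lifted_curve s \<in> V}"
    using V(1) open_contains_ball by (metis mem_Collect_eq)
  let ?e = "min \<epsilon> \<delta>"
  have "{t-?e<..<t+?e} \<subseteq> ball t \<delta>" "{t-?e<..<t+?e} \<subseteq> {t-\<epsilon><..<t+\<epsilon>}"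
    by (auto simp: dist_real_def)
  then have "lifted_curve ` {t-?e<..<t+?e} \<subseteq> V"
    "\<forall>r\<in>{t-?e<..<t+?e}. \<forall>s\<in>{t-?e<..<t+?e}.
       hyp_dist ((\<phi> \<circ> fst) (lifted_curve r)) ((\<phi> \<circ> fst) (lifted_curve s)) = \<bar>r - s\<bar>"
    using \<delta>(2) d by (blast, simp add: fst_lifted_curve subset_iff)
  moreover have "?e > 0" using \<epsilon> \<delta> by simp
  ultimately show "\<exists>\<epsilon>>0. \<exists>(U, \<phi>)\<in>atlas cover_surface. lifted_curve ` {t-\<epsilon><..<t+\<epsilon>} \<subseteq> U \<and>
        (\<forall>r\<in>{t-\<epsilon><..<t+\<epsilon>}. \<forall>s\<in>{t-\<epsilon><..<t+\<epsilon>}. hyp_dist (\<phi> (lifted_curve r)) (\<phi> (lifted_curve s)) = \<bar>r - s\<bar>)"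
    using V(3) by (intro exI[of _ ?e] conjI bexI[of _ "(V, \<phi> \<circ> fst)"]) simp_all
qed

text \<open>Every chart of the cover is a chart of \<open>X\<close> composed with the projection.\<close>

lemma closed_geodesic_fst:
  assumes "closed_geodesic cover_surface \<gamma> L"
  shows "closed_geodesic X (\<lambda>t. fst (\<gamma> t)) L"
  unfolding closed_geodesic_def
proof (intro conjI allI)
  show "L > 0" "fst (\<gamma> (t + L)) = fst (\<gamma> t)" for t
    using assms unfolding closed_geodesic_def by simp_all
  fix t
  obtain \<epsilon> V \<psi> where \<epsilon>: "\<epsilon> > 0" and V\<psi>: "(V, \<psi>) \<in> atlas cover_surface" and \<gamma>V: "\<gamma> ` {t-\<epsilon><..<t+\<epsilon>} \<subseteq> V"
    and d: "\<And>r s. r \<in> {t-\<epsilon><..<t+\<epsilon>} \<Longrightarrow> s \<in> {t-\<epsilon><..<t+\<epsilon>} \<Longrightarrow>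
       hyp_dist (\<psi> (\<gamma> r)) (\<psi> (\<gamma> s)) = \<bar>r - s\<bar>"
    by (rule closed_geodesic_chart[OF assms, of t]) blast
  obtain U \<phi> where U: "(U, \<phi>) \<in> atlas X" "fst ` V \<subseteq> U" "\<psi> = \<phi> \<circ> fst"
    using V\<psi> by (rule atlas_cover_surfaceE)
  have "(\<lambda>t. fst (\<gamma> t)) ` {t-\<epsilon><..<t+\<epsilon>} \<subseteq> U" using \<gamma>V U(2) by blast
  moreover have "\<forall>r\<in>{t-\<epsilon><..<t+\<epsilon>}. \<forall>s\<in>{t-\<epsilon><..<t+\<epsilon>}. hyp_dist (\<phi> (fst (\<gamma> r))) (\<phi> (fst (\<gamma> s))) = \<bar>r - s\<bar>"
    using d by (simp add: U(3))
  ultimately show "\<exists>\<epsilon>>0. \<exists>(U, \<phi>)\<in>atlas X. (\<lambda>t. fst (\<gamma> t)) ` {t-\<epsilon><..<t+\<epsilon>} \<subseteq> U \<and>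
        (\<forall>r\<in>{t-\<epsilon><..<t+\<epsilon>}. \<forall>s\<in>{t-\<epsilon><..<t+\<epsilon>}. hyp_dist (\<phi> (fst (\<gamma> r))) (\<phi> (fst (\<gamma> s))) = \<bar>r - s\<bar>)"
    using \<epsilon> U(1) by (intro exI[of _ \<epsilon>] conjI bexI[of _ "(U, \<phi>)"]) simp_all
qed

text \<open>By uniqueness of lifts the root along \<open>\<gamma>\<close> is a constant multiple of the root along \<open>\<alpha>\<close>. After \<open>l\<close> turns
the latter is multiplied by the \<open>l\<close>-th power of a primitive \<open>m\<close>-th root of unity. As \<open>\<gamma>\<close> is closed,
this power is one, so \<open>m\<close> divides \<open>l\<close>.\<close>

lemma multiple_lifts_length:
  assumes \<gamma>: "closed_geodesic cover_surface \<gamma> L" and mult: "multiple_of (\<lambda>t. fst (\<gamma> t)) L \<alpha> a"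
  shows "real m * a \<le> L"
proof -
  obtain l :: nat where l: "l \<ge> 1" "L = real l * a" using mult unfolding multiple_of_def by blast
  obtain c \<sigma> where \<sigma>: "\<sigma> \<in> {1, -1 :: real}" and \<gamma>\<alpha>: "\<And>t. fst (\<gamma> t) = \<alpha> (\<sigma> * t + c)"
    using mult unfolding multiple_of_def by blast
  have cont: "continuous_map euclideanreal cover_top \<gamma>"
    using closed_geodesic_continuous[OF hyp_surface_cover \<gamma>] by simp
  have \<gamma>_in: "\<gamma> t \<in> total_space" for t using cont by (auto simp: continuous_map_def)
  have g: "continuous_map euclideanreal euclidean (\<lambda>t. root_of (\<gamma> t))"
    using continuous_map_compose[OF cont continuous_root_of] by (simp add: o_def)
  have w: "continuous_map euclideanreal euclidean (\<lambda>t. root_along (\<sigma> * t + c))"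
    by (simp, intro continuous_on_compose2[OF root_along_cont] continuous_intros) auto
  have con: "connected_space euclideanreal"
    by (metis connected_UNIV connectedin_iff_connected connectedin_topspace topspace_euclidean)
  have pw: "root_of (\<gamma> t) ^ m = root_along (\<sigma> * t + c) ^ m" for t
    unfolding root_of_power[OF \<gamma>_in] root_along_power \<gamma>\<alpha> ..
  have nz: "root_along t \<noteq> 0" for t by (simp add: root_along_def)
  obtain \<zeta> where \<zeta>: "\<zeta> ^ m = 1"
      "\<And>t. t \<in> topspace euclideanreal \<Longrightarrow> root_of (\<gamma> t) = \<zeta> * root_along (\<sigma> * t + c)"
    by (rule continuous_same_fibre_roots[OF con g w pw nz]) blast
  have "\<zeta> \<noteq> 0" using \<zeta>(1) m_pos by (auto simp: power_0_left)
  have "\<gamma> L = \<gamma> 0" using \<gamma> unfolding closed_geodesic_def by (metis add_0)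
  then have "\<zeta> * root_along (\<sigma> * L + c) = \<zeta> * root_along c"
    using \<zeta>(2)[of L] \<zeta>(2)[of 0]
    by (metis UNIV_I topspace_euclidean mult_zero_right add_0)
  then have eq: "root_along (\<sigma> * L + c) = root_along c" using \<open>\<zeta> \<noteq> 0\<close> by simp
  \<comment> \<open>The two cases are the two orientations; for \<open>\<sigma> = -1\<close> the turns start at \<open>c - l * a\<close>.\<close>
  have "root_along (c + real l * a) = root_along c \<or> root_along (c - real l * a + real l * a) = root_along (c - real l * a)"
    using \<sigma> eq l(2) by (auto simp: add.commute)
  then have "cis (2 * pi * real l / real m) = 1"
    unfolding root_along_shift by (auto simp: root_along_def)
  then obtain i :: int where "2 * pi * real l / real m = 2 * pi * of_int i"
    by (auto simp: complex_eq_iff cos_one_2pi_int)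
  then have "real l = of_int i * real m" using m_pos by (simp add: field_simps)
  then have "int l = i * int m" by (metis of_int_eq_iff of_int_mult of_int_of_nat_eq)
  then have "int m dvd int l" by simp
  then have "m \<le> l" using l(1) by (simp add: dvd_imp_le)
  then show ?thesis using a_pos l(2) by simp
qed

lemma systole_of_cover:
  assumes "\<And>\<gamma> L. closed_geodesic X \<gamma> L \<Longrightarrow> \<not> multiple_of \<gamma> L \<alpha> a \<Longrightarrow> real m * a \<le> L"
  shows "systole_length cover_surface (real m * a)"
  unfolding systole_length_def is_systole_def
  using lifted_curve_geodesic closed_geodesic_fst multiple_lifts_length assms by blast

end

text \<open>The \<open>i\<close>-th cover is the root cover of degree \<open>i + 1\<close> of the function that \<open>pants_function\<close> induces on \<open>X\<close>; its
systole has length \<open>(i + 1) * a\<close>.\<close>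

theorem theorem6p3:
  fixes k n :: nat and a :: real
    and P :: "'p hyp_surface" and \<gamma>1 \<gamma>2 :: "real \<Rightarrow> 'p"
    and X :: "'a hyp_surface" and q :: "'p \<Rightarrow> 'a" and \<alpha> :: "real \<Rightarrow> 'a"
  assumes "k > 0" and "n = 2 ^ k"
    and "a = 1 / real n * (2 * ln (1 + sqrt 2))"
    and "hyp_structure_on P pair_of_pants"
    and "boundary_geodesic P \<gamma>1 a" and "boundary_geodesic P \<gamma>2 a" and "range \<gamma>1 \<noteq> range \<gamma>2"
    and "hyp_structure_on X one_holed_torus"
    and "glued_along P \<gamma>1 \<gamma>2 q X"
    and "\<alpha> = (\<lambda>t. q (\<gamma>1 t))" and "is_systole X \<alpha> a"
    and "\<exists>\<beta> b. next_shortest X \<alpha> a \<beta> b \<and> a < 1 / real n * b \<and> b \<ge> 2 * ln (1 + sqrt 2)"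
    and "\<forall>(Y :: 'a covering_surface) p L.
           hyp_cover Y X p \<and> cover_degree Y X p n \<and> systole_length Y L \<longrightarrow> L \<le> real n * a"
  shows "\<exists>(Y :: nat \<Rightarrow> 'a covering_surface) p L.
           (\<forall>i<k. cyclic_cover (Y i) X (p i) \<and> systole_length (Y i) (L i)) \<and>
           inj_on L {..<k}"
proof -
  have P: "hyp_surface P" and X: "hyp_surface X"
    using assms(4,8) unfolding hyp_structure_on_def by auto
  have geo: "closed_geodesic X \<alpha> a" using assms(11) unfolding is_systole_def by blast
  then have "a > 0" unfolding closed_geodesic_def by blast
  obtain h where h: "homeomorphic_map (topo P) (top_of_set pair_of_pants) h"
    using assms(4) unfolding hyp_structure_on_def homeomorphic_space by blast
  have hc: "continuous_map (topo P) (top_of_set pair_of_pants) h"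
    using homeomorphic_imp_continuous_map[OF h] .
  have \<gamma>P: "range \<gamma> \<subseteq> topspace (topo P)" if "boundary_geodesic P \<gamma> a" for \<gamma>
  proof -
    have "continuous_map euclideanreal (topo P) \<gamma>"
      using that closed_geodesic_continuous[OF P] unfolding boundary_geodesic_def by blast
    then show ?thesis by (auto simp: continuous_map_def)
  qed
  have "h ` range \<gamma>1 \<noteq> h ` range \<gamma>2"
    using inj_on_image_eq_iff[OF homeomorphic_imp_injective_map[OF h] \<gamma>P[OF assms(5)] \<gamma>P[OF assms(6)]] assms(7)
    by simp
  then have "range (\<lambda>t. h (\<gamma>1 t)) \<noteq> range (\<lambda>t. h (\<gamma>2 t))" by (simp add: image_image)
  note b1 = boundary_geodesic_in_pants[OF P h assms(5)] and b2 = boundary_geodesic_in_pants[OF P h assms(6)]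
  obtain G u where G: "continuous_on pair_of_pants G" "\<And>z. z \<in> pair_of_pants \<Longrightarrow> G z \<noteq> 0"
    and u: "continuous_on UNIV u" "\<And>t. u (t + a) = u t + 2 * pi * \<i>"
    and Gu: "\<And>t. G (h (\<gamma>1 t)) = exp (u t)" "\<And>t. G (h (\<gamma>2 t)) = exp (u t)"
    by (rule pants_function[OF \<open>a > 0\<close> b1(3,4,2,1) b2(3,4,2,1)
          \<open>range (\<lambda>t. h (\<gamma>1 t)) \<noteq> range (\<lambda>t. h (\<gamma>2 t))\<close>]) blast
  have quot: "quotient_map (topo P) (topo X) q"
    and fibres: "\<And>x y. x \<in> topspace (topo P) \<Longrightarrow> y \<in> topspace (topo P) \<Longrightarrow> q x = q y \<longleftrightarrow>
        x = y \<or> (\<exists>t. x = \<gamma>1 t \<and> y = \<gamma>2 t) \<or> (\<exists>t. x = \<gamma>2 t \<and> y = \<gamma>1 t)"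
    using assms(9) unfolding glued_along_def by auto
  have "continuous_map (topo P) euclidean (\<lambda>x. G (h x))"
    using continuous_map_compose[OF hc, of euclidean G] G(1) by (simp add: o_def)
  moreover have "G (h x) = G (h y)"
    if "x \<in> topspace (topo P)" "y \<in> topspace (topo P)" "q x = q y" for x y
    using fibres[OF that(1,2)] that(3) Gu by auto
  ultimately obtain f where f: "continuous_map (topo X) euclidean f" "f ` topspace (topo X) = (\<lambda>x. G (h x)) ` topspace (topo P)"
    "\<And>x. x \<in> topspace (topo P) \<Longrightarrow> f (q x) = G (h x)"
    by (rule quotient_map_lift_exists[OF quot]) blast+
  have f0: "f x \<noteq> 0" if x: "x \<in> topspace (topo X)" for x
  proof -
    obtain y where "y \<in> topspace (topo P)" "f x = G (h y)" using f(2) x by blast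
    moreover from this have "h y \<in> pair_of_pants" using hc by (auto simp: continuous_map_def)
    ultimately show ?thesis using G(2) by simp
  qed
  have f\<alpha>: "f (\<alpha> t) = exp (u t)" for t
    using f(3)[of "\<gamma>1 t"] \<gamma>P[OF assms(5)] Gu(1) by (auto simp: assms(10))
  have "topo X homeomorphic_space top_of_set one_holed_torus"
    using assms(8) unfolding hyp_structure_on_def by blast
  then have conX: "connected_space (topo X)"
    using homeomorphic_connected_space connected_one_holed_torus by (metis connectedin_def connectedin_iff_connected)
  obtain \<beta> b where ns: "next_shortest X \<alpha> a \<beta> b" and ab: "a < 1 / real n * b"
    using assms(12) by blast
  have "n > 0" using assms(2) by simp
  then have nab: "real n * a < b" using ab by (simp add: field_simps)
  have unwrap: "geodesic_unwrapping X f m \<alpha> a u" if "m > 0" for m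
    using X f(1) f0 that conX geo u f\<alpha>
    by (intro geodesic_unwrapping.intro cyclic_root_cover.intro geodesic_unwrapping_axioms.intro) auto
  let ?Y = "\<lambda>i. cyclic_root_cover.cover_surface X f (Suc i)"
  have "cyclic_cover (?Y i) X fst \<and> systole_length (?Y i) (real (Suc i) * a)" if "i < k" for i
  proof -
    interpret geodesic_unwrapping X f "Suc i" \<alpha> a u by (rule unwrap) simp
    have "Suc i \<le> n" using that assms(2) less_exp[of k] by linarith
    then have "real (Suc i) * a \<le> real n * a" using \<open>a > 0\<close> by (intro mult_right_mono) auto
    then have "real (Suc i) * a \<le> L" if "closed_geodesic X \<gamma> L" "\<not> multiple_of \<gamma> L \<alpha> a" for \<gamma> L
      using ns nab that unfolding next_shortest_def by fastforce
    then show ?thesis using cyclic_cover_surface systole_of_cover by blast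
  qed
  moreover have "inj_on (\<lambda>i. real (Suc i) * a) {..<k}"
    using \<open>a > 0\<close> by (auto simp: inj_on_def)
  ultimately show ?thesis
    by (intro exI[of _ ?Y] exI[of _ "\<lambda>_. fst"] exI[of _ "\<lambda>i. real (Suc i) * a"]) blast
qed

end
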